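(* Let $\mathcal{K}=Alt$ or $\mathcal{K}=Sym$. Then any quotient of a direct product $\prod_{i\in\mathbb{N}}H_i$ with $H_i\in\mathcal{K}$ is $\mathcal{K}$-approximable.
   Context: $Alt$ and $Sym$ are the classes of finite alternating groups and finite symmetric groups. Direct products are unrestricted. For a group $H$, $X\subseteq H$ and $n\in\mathbb{N}$, put $C_n(X,H)=\{x_1^{g_1}\cdots x_n^{g_n} : x_i\in X\text{ or }x_i^{-1}\in X,\ g_i\in H\}$, where $x^g=g^{-1}xg$. A set $Y\subseteq H$ is $n$-separated from $X$ in $H$ if $Y\cap C_n(X,H)=\emptyset$. A group $G$ is $\mathcal{K}$-approximable if for every finite $\Phi\subset G$ and every $n\in\mathbb{N}$ there exist $H\in\mathcal{K}$ and a map $\phi:\Phi\to H$ such that $\phi(1)=1$ (when $1\in\Phi$) and $\phi(\Phi\setminus\{1\})$ is $n$-separated in $H$ from $\{\phi(g)\phi(h)(\phi(gh))^{-1} : g,h,gh\in\Phi\}$. *)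

theory Defs
  imports "HOL-Algebra.Sym_Groups" "HOL-Algebra.Product_Groups"
begin

text \<open>The classes are closed under isomorphism and are polymorphic in the type of group elements.
  The requirement \<open>group H\<close> is not redundant: an isomorphism in the sense of the library does not
  force its domain to be a group. The degree \<open>n = 0\<close> only contributes the trivial group.\<close>

definition Alt :: "'a monoid set" where
  "Alt = {H. group H \<and> (\<exists>n. H \<cong> alt_group n)}"

definition Sym :: "'a monoid set" where
  "Sym = {H. group H \<and> (\<exists>n. H \<cong> sym_group n)}"

text \<open>A list of pairs \<open>(x, g)\<close> encodes the product of the conjugates
  \<open>x\<^sup>g = g\<inverse> x g\<close>, in list order; for \<open>n = 0\<close> the only such product is the identity.\<close>

definition conj_prods :: "nat \<Rightarrow> 'a set \<Rightarrow> 'a monoid \<Rightarrow> 'a set" where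
  "conj_prods n X H =
    {foldr (\<otimes>\<^bsub>H\<^esub>) (map (\<lambda>(x, g). inv\<^bsub>H\<^esub> g \<otimes>\<^bsub>H\<^esub> x \<otimes>\<^bsub>H\<^esub> g) ps) \<one>\<^bsub>H\<^esub> | ps.
       length ps = n \<and>
       (\<forall>(x, g) \<in> set ps. x \<in> carrier H \<and> (x \<in> X \<or> inv\<^bsub>H\<^esub> x \<in> X) \<and> g \<in> carrier H)}"

definition separated_from :: "nat \<Rightarrow> 'a set \<Rightarrow> 'a set \<Rightarrow> 'a monoid \<Rightarrow> bool" where
  "separated_from n Y X H \<longleftrightarrow> Y \<inter> conj_prods n X H = {}"

definition approximable :: "'a monoid set \<Rightarrow> 'b monoid \<Rightarrow> bool" where
  "approximable K G \<longleftrightarrow>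
    (\<forall>\<Phi> n. finite \<Phi> \<and> \<Phi> \<subseteq> carrier G \<longrightarrow>
      (\<exists>H \<in> K. \<exists>\<phi> \<in> \<Phi> \<rightarrow> carrier H.
         (\<one>\<^bsub>G\<^esub> \<in> \<Phi> \<longrightarrow> \<phi> \<one>\<^bsub>G\<^esub> = \<one>\<^bsub>H\<^esub>) \<and>
         separated_from n (\<phi> ` (\<Phi> - {\<one>\<^bsub>G\<^esub>}))
           {\<phi> g \<otimes>\<^bsub>H\<^esub> \<phi> h \<otimes>\<^bsub>H\<^esub> inv\<^bsub>H\<^esub> (\<phi> (g \<otimes>\<^bsub>G\<^esub> h)) | g h.
              g \<in> \<Phi> \<and> h \<in> \<Phi> \<and> g \<otimes>\<^bsub>G\<^esub> h \<in> \<Phi>} H))"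

end

theory Submission
  imports Defs "HOL-Algebra.SndIsomorphismGrp"
begin

text \<open>Everything is measured by the number of points that a permutation moves. If \<open>x\<close> moves
  sufficiently many points compared with an even permutation \<open>e\<close>, then \<open>e\<close> is a product of a
  uniformly bounded number of elements \<open>x\<^sup>u (x\<inverse>)\<^sup>v\<close> with \<open>u\<close>, \<open>v\<close> even. Applied in all
  coordinates at once, this shows that an element \<open>f\<close> of the product lies in the normal subgroup
  \<open>N\<close> if its coordinates are even, trivial in the factors of small degree, and move at most a
  constant times as many points as finitely many elements of \<open>N\<close> do. So \<open>f \<notin> N\<close> has one of
  two reasons. Either some coordinate of \<open>f\<close> moves far more points than the defects of a chosen
  section of \<open>\<Prod>H\<^sub>i \<rightarrow> \<Prod>H\<^sub>i / N\<close>; then that coordinate serves as approximation. Or \<open>f\<close> is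
  nontrivial modulo \<open>N\<close> and the even permutations in the factors of large degree; that quotient is
  locally finite, and a regular representation of a finite piece of it serves. Finally, disjoint
  unions of suitably many copies combine the approximations for the individual \<open>f\<close>, and two
  additional points make all permutations even.\<close>

section \<open>Products of disjoint transpositions\<close>

fun swaps :: "'a list \<Rightarrow> 'a \<Rightarrow> 'a" where
  "swaps (a # b # zs) = transpose a b \<circ> swaps zs"
| "swaps [a] = id"
| "swaps [] = id"

lemma swaps_permutes: "set zs \<subseteq> A \<Longrightarrow> swaps zs permutes A"
  by (induction zs rule: swaps.induct) (auto intro!: permutes_compose permutes_swap_id permutes_id)

lemma swaps_permutation: "permutation (swaps zs)"
  using permutes_imp_permutation[OF _ swaps_permutes[OF order_refl]] by simp

lemma swaps_append: "even (length xs) \<Longrightarrow> swaps (xs @ ys) = swaps xs \<circ> swaps ys"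
  by (induction xs rule: swaps.induct) (auto simp: comp_assoc)

lemma swaps_map:
  assumes "bij u"
  shows "u \<circ> swaps zs = swaps (map u zs) \<circ> u"
proof (induction zs rule: swaps.induct)
  case (1 a b zs)
  have "u \<circ> transpose a b = transpose (u a) (u b) \<circ> u"
    using assms by (auto simp: fun_eq_iff transpose_def bij_def inj_eq)
  then have "u \<circ> swaps (a # b # zs) = transpose (u a) (u b) \<circ> (u \<circ> swaps zs)"
    by (metis comp_assoc swaps.simps(1))
  then show ?case by (simp only: 1 list.map swaps.simps comp_assoc)
qed auto

lemma evenperm_swaps: "distinct zs \<Longrightarrow> evenperm (swaps zs) \<longleftrightarrow> even (length zs div 2)"
proof (induction zs rule: swaps.induct)
  case (1 a b zs)
  then show ?case
    using evenperm_comp[OF permutation_swap_id swaps_permutation, of a b zs]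
    unfolding swaps.simps by (simp add: evenperm_swap comp_def)
qed auto

lemma permutes_disjoint_commute:
  assumes "p permutes A" "q permutes B" "A \<inter> B = {}"
  shows "p \<circ> q = q \<circ> p"
proof
  fix z
  consider "z \<in> A" "z \<notin> B" | "z \<in> B" "z \<notin> A" | "z \<notin> A" "z \<notin> B" using assms(3) by blast
  then show "(p \<circ> q) z = (q \<circ> p) z"
  proof cases
    case 1
    then have "p z \<notin> B" using assms permutes_in_image[OF assms(1), of z] by blast
    then show ?thesis using 1 assms by (simp add: permutes_not_in)
  next
    case 2
    then have "q z \<notin> A" using assms permutes_in_image[OF assms(2), of z] by blast
    then show ?thesis using 2 assms by (simp add: permutes_not_in)
  qed (use assms in \<open>simp add: permutes_not_in\<close>)
qed

lemma swaps_swaps: "distinct zs \<Longrightarrow> swaps zs \<circ> swaps zs = id"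
proof (induction zs rule: swaps.induct)
  case (1 a b zs)
  have "swaps zs \<circ> transpose a b = transpose a b \<circ> swaps zs"
    by (rule permutes_disjoint_commute[OF swaps_permutes[OF order_refl] permutes_swap_id[of a "{a,b}" b]])
      (use 1 in auto)
  then have "transpose a b \<circ> swaps zs \<circ> (transpose a b \<circ> swaps zs)
      = transpose a b \<circ> transpose a b \<circ> (swaps zs \<circ> swaps zs)"
    by (metis comp_assoc)
  then show ?case using 1 by (simp only: swaps.simps) (simp add: comp_def)
qed auto

definition moved :: "('a \<Rightarrow> 'a) \<Rightarrow> 'a set" where
  "moved p = {z. p z \<noteq> z}"

lemma moved_permutes: "p permutes A \<Longrightarrow> moved p \<subseteq> A"
  by (auto simp: moved_def permutes_def)

lemma finite_moved: "p permutes A \<Longrightarrow> finite A \<Longrightarrow> finite (moved p)"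
  using moved_permutes finite_subset by blast

lemma moved_id [simp]: "moved id = {}"
  by (simp add: moved_def)

lemma moved_eq_empty: "moved p = {} \<longleftrightarrow> p = id"
  by (auto simp: moved_def fun_eq_iff)

lemma moved_comp: "moved (p \<circ> q) \<subseteq> moved p \<union> moved q"
  by (auto simp: moved_def)

lemma moved_inv: "bij p \<Longrightarrow> moved (inv' p) = moved p"
  unfolding moved_def by (metis bij_inv_eq_iff)

lemma moved_conj:
  assumes "bij u"
  shows "moved (u \<circ> p \<circ> inv' u) = u ` moved p"
proof (rule Set.set_eqI)
  fix z
  obtain y where z: "z = u y" using assms by (metis bij_pointE)
  have "inj u" using assms by (rule bij_is_inj)
  then show "z \<in> moved (u \<circ> p \<circ> inv' u) \<longleftrightarrow> z \<in> u ` moved p"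
    by (simp add: z moved_def inj_image_mem_iff inj_eq)
qed

lemma card_moved_conj: "bij u \<Longrightarrow> card (moved (u \<circ> p \<circ> inv' u)) = card (moved p)"
  by (metis bij_is_inj card_image inj_on_subset moved_conj subset_UNIV)

lemma card_moved_comp:
  assumes "finite (moved p)" "finite (moved q)"
  shows "card (moved (p \<circ> q)) \<le> card (moved p) + card (moved q)"
  by (meson assms card_Un_le card_mono finite_UnI le_trans moved_comp)

lemma involution_eq_swaps:
  assumes "finite (moved p)" "p \<circ> p = id"
  shows "\<exists>zs. distinct zs \<and> even (length zs) \<and> set zs = moved p \<and> p = swaps zs"
  using assms
proof (induction "card (moved p)" arbitrary: p rule: less_induct)
  case less
  have pp: "p (p z) = z" for z using less.prems(2) by (metis comp_apply id_apply)
  show ?case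
  proof (cases "moved p = {}")
    case True
    then show ?thesis by (intro exI[of _ "[]"]) (simp add: moved_eq_empty)
  next
    case False
    then obtain a where a: "p a \<noteq> a" by (auto simp: moved_def)
    define q where "q = transpose a (p a) \<circ> p"
    have qz: "q z = (if z = a \<or> z = p a then z else p z)" for z
      using pp by (simp add: q_def transpose_def) metis
    have mq: "moved q = moved p - {a, p a}" by (auto simp: moved_def qz)
    have "a \<in> moved p" using a by (simp add: moved_def)
    then have "card (moved q) < card (moved p)"
      using less.prems(1) mq by (metis Diff_iff insertI1 psubset_card_mono psubsetI Diff_subset)
    moreover have "q \<circ> q = id" by (auto simp: fun_eq_iff qz pp) (metis pp)+
    ultimately obtain zs where zs: "distinct zs" "even (length zs)" "set zs = moved q" "q = swaps zs"
      using less.hyps[of q] less.prems(1) mq by auto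
    have "p = swaps (a # p a # zs)"
      using zs(4) by (simp add: q_def flip: zs(4) comp_assoc)
    moreover have "p a \<in> moved p" using a pp[of a] by (simp add: moved_def)
    then have "set (a # p a # zs) = moved p" using \<open>a \<in> moved p\<close> zs(3) mq by auto
    moreover have "distinct (a # p a # zs)" "even (length (a # p a # zs))" using zs a mq by auto
    ultimately show ?thesis by blast
  qed
qed

text \<open>On each cycle choose a base point \<open>r\<close> and send \<open>(p ^^ k) r\<close> to its mirror image under the
  reflection of the cycle fixing \<open>r\<close>. This involution conjugates \<open>p\<close> to its inverse.\<close>

lemma permutation_two_involutions:
  assumes "finite A" "p permutes A"
  shows "\<exists>i j. i \<circ> i = id \<and> j \<circ> j = id \<and> moved i \<subseteq> moved p \<and> moved j \<subseteq> moved p \<and> p = i \<circ> j"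
proof -
  have bij: "bij p" and perm: "permutation p"
    using assms permutes_bij permutes_imp_permutation by blast+
  have bijn: "bij (p ^^ k)" for k using bij by (simp add: bij_fn)
  let ?q = "inv' p"
  have qp: "?q (p z) = z" "p (?q z) = z" for z
    using bij by (simp_all add: bij_is_inj bij_is_surj surj_f_inv_f)
  have qnp: "(?q ^^ k) ((p ^^ k) z) = z" "(p ^^ k) ((?q ^^ k) z) = z" for k z
    using bijn[of k] inv_fn[OF bij, of k] by (metis bij_is_inj inv_f_f, metis bij_is_surj surj_f_inv_f)
  have ret: "\<exists>j. (p ^^ j) ((p ^^ k) z) = z" for k z
  proof -
    obtain n where n: "n > 0" "(p ^^ n) = id" using permutation_is_nilpotent[OF perm] by blast
    have "p ^^ (n * k) = id" by (simp only: n flip: funpow_mult) simp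
    then have "(p ^^ (n * k)) z = z" by simp
    moreover have "k \<le> n * k" using n(1) by simp
    ultimately have "(p ^^ (n * k - k)) ((p ^^ k) z) = z"
      using funpow_add[of "n * k - k" k p] by simp
    then show ?thesis by blast
  qed
  define O' where "O' z = range (\<lambda>k. (p ^^ k) z)" for z
  have O_eq: "O' ((p ^^ k) z) = O' z" for k z
  proof
    show "O' ((p ^^ k) z) \<subseteq> O' z" 

    proof
      fix y assume "y \<in> O' ((p ^^ k) z)"
      then obtain l where "y = (p ^^ l) ((p ^^ k) z)" by (auto simp: O'_def)
      then have "y = (p ^^ (l + k)) z" by (simp add: funpow_add)
      then show "y \<in> O' z" unfolding O'_def by blast
    qed
    obtain j where "(p ^^ j) ((p ^^ k) z) = z" using ret by blast
    then have "(p ^^ l) z = (p ^^ (l + j)) ((p ^^ k) z)" for l by (simp add: funpow_add)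
    then show "O' z \<subseteq> O' ((p ^^ k) z)" unfolding O'_def by blast
  qed
  define b where "b z = (SOME y. y \<in> O' z)" for z
  have b_in: "\<exists>k. (p ^^ k) (b z) = z" for z
  proof -
    have "b z \<in> O' z" unfolding b_def by (rule someI[of _ "(p ^^ 0) z"]) (simp add: O'_def, rule range_eqI[of _ _ 0], simp)
    then show ?thesis using ret by (auto simp: O'_def)
  qed
  have b_pow: "b ((p ^^ k) z) = b z" for k z by (simp add: b_def O_eq)
  define i where "i z = (?q ^^ (SOME k. (p ^^ k) (b z) = z)) (b z)" for z
  have uniq: "(?q ^^ k) r = (?q ^^ l) r" if "(p ^^ k) r = (p ^^ l) r" for k l r
  proof -
    have *: "(?q ^^ k) r = (?q ^^ (k + d)) r" if "(p ^^ k) r = (p ^^ (k + d)) r" for k d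
    proof -
      have "(p ^^ k) r = (p ^^ k) ((p ^^ d) r)" using that by (simp add: funpow_add)
      then have "(p ^^ d) r = r" by (metis qnp(1))
      then have "(?q ^^ d) r = r" by (metis qnp(1))
      then show ?thesis by (simp add: funpow_add)
    qed
    show ?thesis
    proof (cases "k \<le> l")
      case True then show ?thesis using *[of k "l - k"] that by simp
    next
      case False then show ?thesis using *[of l "k - l"] that by simp
    qed
  qed
  have i_eq: "i ((p ^^ k) (b z)) = (?q ^^ k) (b z)" for k z
  proof -
    have bz: "b ((p ^^ k) (b z)) = b z"
      using b_pow[of k "b z"] b_pow b_in[of z] by metis
    show ?thesis unfolding i_def bz
      by (rule uniq) (rule someI[of "\<lambda>l. (p ^^ l) (b z) = (p ^^ k) (b z)" k], rule refl)
  qed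
  have ii: "i (i z) = z" for z
  proof -
    obtain k where k: "(p ^^ k) (b z) = z" using b_in by blast
    obtain j where j: "(p ^^ j) ((p ^^ k) (b z)) = b z" using ret by blast
    have "(?q ^^ k) (b z) = (p ^^ j) (b z)"
    proof -
      have "(p ^^ k) ((p ^^ j) (b z)) = b z"
        using j fun_cong[OF funpow_add[of j k p], of "b z"] fun_cong[OF funpow_add[of k j p], of "b z"]
        by (simp add: add.commute)
      then show ?thesis using qnp(1)[of k "(p ^^ j) (b z)"] by simp
    qed
    moreover have "(?q ^^ j) (b z) = z" using qnp(1)[of j z] j k by simp
    ultimately show ?thesis using i_eq[of k z] i_eq[of j z] k by simp
  qed
  have ip: "i (p (i (p z))) = z" for z
  proof -
    obtain k where k: "(p ^^ k) (b z) = z" using b_in by blast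
    have "i (p z) = (?q ^^ Suc k) (b z)" using i_eq[of "Suc k" z] k by simp
    then have "p (i (p z)) = i z" using i_eq[of k z] k qp by simp
    then show ?thesis using ii by simp
  qed
  have mi: "moved i \<subseteq> moved p"
  proof -
    have "i z = z" if "p z = z" for z
    proof -
      have fix_pow: "(p ^^ k) z = z" for k using that by (induction k) auto
      have "O' z = {z}" by (auto simp: O'_def fix_pow)
      then have "b z = z" by (simp add: b_def)
      then show ?thesis using i_eq[of 0 z] by simp
    qed
    then show ?thesis by (auto simp: moved_def)
  qed
  have "i \<circ> i = id" "(i \<circ> p) \<circ> (i \<circ> p) = id" "p = i \<circ> (i \<circ> p)"
    using ii ip by (auto simp: fun_eq_iff)
  moreover have "moved (i \<circ> p) \<subseteq> moved p" using moved_comp[of i p] mi by blast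
  ultimately show ?thesis using mi by blast
qed

section \<open>Even permutations as products of conjugates\<close>

lemma alt_comp: "u \<in> carrier (alt_group m) \<Longrightarrow> v \<in> carrier (alt_group m) \<Longrightarrow> u \<circ> v \<in> carrier (alt_group m)"
  using group.subgroup_self[OF alt_group_is_group] subgroup.m_closed by (metis alt_group_mult)

lemma alt_bij: "u \<in> carrier (alt_group m) \<Longrightarrow> bij u"
  unfolding alt_group_carrier using permutes_bij by blast

lemma id_in_alt: "id \<in> carrier (alt_group m)"
  by (simp add: alt_group_carrier)

lemma conj_conj: "bij u \<Longrightarrow> bij v \<Longrightarrow> u \<circ> (v \<circ> x \<circ> inv' v) \<circ> inv' u = (u \<circ> v) \<circ> x \<circ> inv' (u \<circ> v)"
  by (simp add: o_inv_distrib comp_assoc)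

lemma inv_conj: "bij u \<Longrightarrow> bij x \<Longrightarrow> inv' (u \<circ> x \<circ> inv' u) = u \<circ> inv' x \<circ> inv' u"
  by (simp add: o_inv_distrib bij_imp_bij_inv bij_comp inv_inv_eq comp_assoc)

definition conj_quot :: "nat \<Rightarrow> (nat \<Rightarrow> nat) \<Rightarrow> (nat \<Rightarrow> nat) set" where
  "conj_quot m x = {(u \<circ> x \<circ> inv' u) \<circ> (v \<circ> inv' x \<circ> inv' v) | u v.
     u \<in> carrier (alt_group m) \<and> v \<in> carrier (alt_group m)}"

primrec conj_quots :: "nat \<Rightarrow> (nat \<Rightarrow> nat) \<Rightarrow> nat \<Rightarrow> (nat \<Rightarrow> nat) set" where
  "conj_quots m x 0 = {id}"
| "conj_quots m x (Suc k) = {d \<circ> r | d r. d \<in> conj_quot m x \<and> r \<in> conj_quots m x k}"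

lemma conj_quotI:
  assumes "u \<in> carrier (alt_group m)" "v \<in> carrier (alt_group m)"
  shows "(u \<circ> x \<circ> inv' u) \<circ> (v \<circ> inv' x \<circ> inv' v) \<in> conj_quot m x"
  using assms by (auto simp: conj_quot_def)

lemma conj_quots_1: "conj_quots m x (Suc 0) = conj_quot m x"
  by simp

lemma conj_quots_comp:
  "d \<in> conj_quots m x j \<Longrightarrow> e \<in> conj_quots m x k \<Longrightarrow> d \<circ> e \<in> conj_quots m x (j + k)"
proof (induction j arbitrary: d)
  case (Suc j)
  then obtain a b where "d = a \<circ> b" "a \<in> conj_quot m x" "b \<in> conj_quots m x j" by auto
  moreover from this have "b \<circ> e \<in> conj_quots m x (j + k)" using Suc by blast
  ultimately have "a \<circ> (b \<circ> e) \<in> conj_quots m x (Suc (j + k))"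
    unfolding conj_quots.simps by blast
  then show ?case using \<open>d = a \<circ> b\<close> by (simp only: comp_assoc add_Suc)
qed simp

lemma id_in_conj_quot: "bij x \<Longrightarrow> id \<in> conj_quot m x"
  using conj_quotI[OF id_in_alt id_in_alt, of x m] bij_is_surj surj_iff
  by (metis comp_id id_comp inv_id)

lemma id_in_conj_quots: "bij x \<Longrightarrow> id \<in> conj_quots m x k"
proof (induction k)
  case (Suc k)
  then have "id \<circ> id \<in> conj_quots m x (Suc k)"
    unfolding conj_quots.simps using id_in_conj_quot by blast
  then show ?case by (simp only: comp_id)
qed simp

lemma conj_quots_mono:
  assumes "bij x" "j \<le> k"
  shows "conj_quots m x j \<subseteq> conj_quots m x k"
  using conj_quots_comp[of _ m x j id "k - j"] id_in_conj_quots[OF assms(1), of m "k - j"] assms(2)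
  by auto

lemma conj_quot_inv:
  assumes "bij x" "d \<in> conj_quot m x"
  shows "inv' d \<in> conj_quot m x"
proof -
  obtain u v where uv: "d = (u \<circ> x \<circ> inv' u) \<circ> (v \<circ> inv' x \<circ> inv' v)"
    and "u \<in> carrier (alt_group m)" "v \<in> carrier (alt_group m)"
    using assms(2) by (auto simp: conj_quot_def)
  then have b: "bij u" "bij v" using alt_bij by auto
  have "inv' d = inv' (v \<circ> inv' x \<circ> inv' v) \<circ> inv' (u \<circ> x \<circ> inv' u)"
    unfolding uv by (intro o_inv_distrib) (auto intro!: bij_comp bij_imp_bij_inv b assms(1))
  also have "\<dots> = (v \<circ> x \<circ> inv' v) \<circ> (u \<circ> inv' x \<circ> inv' u)"
    using b assms(1) by (simp add: inv_conj bij_imp_bij_inv inv_inv_eq)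
  finally show ?thesis using conj_quotI \<open>u \<in> _\<close> \<open>v \<in> _\<close> by metis
qed

lemma conj_quot_conj:
  assumes "bij x" "d \<in> conj_quot m x" "w \<in> carrier (alt_group m)"
  shows "w \<circ> d \<circ> inv' w \<in> conj_quot m x"
proof -
  obtain u v where uv: "d = (u \<circ> x \<circ> inv' u) \<circ> (v \<circ> inv' x \<circ> inv' v)"
    and "u \<in> carrier (alt_group m)" "v \<in> carrier (alt_group m)"
    using assms(2) by (auto simp: conj_quot_def)
  then have b: "bij u" "bij v" "bij w" using alt_bij assms by auto
  have w: "inv' w \<circ> w = id" using b(3) by (simp add: bij_is_inj)
  have "w \<circ> d \<circ> inv' w
      = (w \<circ> (u \<circ> x \<circ> inv' u) \<circ> inv' w) \<circ> (w \<circ> (v \<circ> inv' x \<circ> inv' v) \<circ> inv' w)"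
  proof -
    have "(w \<circ> p \<circ> inv' w) \<circ> (w \<circ> q \<circ> inv' w) = w \<circ> (p \<circ> q) \<circ> inv' w" for p q :: "nat \<Rightarrow> nat"
      by (auto simp: fun_eq_iff inv_f_f[OF bij_is_inj[OF b(3)]])
    then show ?thesis by (simp only: uv)
  qed
  also have "\<dots> = ((w \<circ> u) \<circ> x \<circ> inv' (w \<circ> u)) \<circ> ((w \<circ> v) \<circ> inv' x \<circ> inv' (w \<circ> v))"
    using b by (simp only: conj_conj)
  finally show ?thesis using conj_quotI[OF alt_comp alt_comp] \<open>u \<in> _\<close> \<open>v \<in> _\<close> assms(3) by metis
qed

lemma conj_quots_trans:
  assumes "bij x" "bij y" "y \<in> conj_quot m x"
  shows "conj_quots m y k \<subseteq> conj_quots m x (2 * k)"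
proof (induction k)
  case (Suc k)
  have "d \<in> conj_quots m x 2" if d: "d \<in> conj_quot m y" for d
  proof -
    obtain u v where uv: "d = (u \<circ> y \<circ> inv' u) \<circ> (v \<circ> inv' y \<circ> inv' v)"
      and "u \<in> carrier (alt_group m)" "v \<in> carrier (alt_group m)"
      using d by (auto simp: conj_quot_def)
    then have "u \<circ> y \<circ> inv' u \<in> conj_quots m x 1" "v \<circ> inv' y \<circ> inv' v \<in> conj_quots m x 1"
      using assms by (simp_all only: One_nat_def conj_quots_1) (blast intro: conj_quot_conj conj_quot_inv)+
    then show ?thesis using conj_quots_comp uv by (metis one_add_one)
  qed
  then have "d \<circ> r \<in> conj_quots m x (2 + 2 * k)"
    if "d \<in> conj_quot m y" "r \<in> conj_quots m y k" for d r
    using that Suc conj_quots_comp by blast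
  then show ?case by (auto simp del: conj_quots.simps(2) simp: conj_quots.simps(2)[of m y])
qed simp

lemma permutes_extend_list:
  assumes "finite A" "distinct as" "distinct bs" "length as = length bs" "set as \<subseteq> A" "set bs \<subseteq> A"
  shows "\<exists>u. u permutes A \<and> map u as = bs"
  using assms(4,2,3,5,6)
proof (induction as bs rule: list_induct2)
  case Nil
  show ?case by (intro exI[of _ id] conjI permutes_id) simp
next
  case (Cons a as b bs)
  then obtain u where u: "u permutes A" "map u as = bs" by auto
  have "transpose (u a) b \<circ> u permutes A"
    using Cons.prems u(1) by (intro permutes_compose permutes_swap_id) (auto simp: permutes_in_image)
  moreover have "transpose (u a) b (u c) = u c" if "c \<in> set as" for c
  proof -
    have "u c \<noteq> u a" using that Cons.prems u(1) by (auto dest!: permutes_inj simp: inj_eq)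
    moreover have "u c \<noteq> b" using that Cons.prems u(2) by auto
    ultimately show ?thesis by (simp add: transpose_def)
  qed
  then have "map (transpose (u a) b \<circ> u) (a # as) = b # bs" using u(2) by auto
  ultimately show ?case by (intro exI[of _ "transpose (u a) b \<circ> u"] conjI)
qed

lemma alt_extend_list:
  assumes "distinct as" "distinct bs" "length as = length bs" "set as \<subseteq> {1..m}" "set bs \<subseteq> {1..m}"
    and "length bs + 2 \<le> m"
  shows "\<exists>u \<in> carrier (alt_group m). map u as = bs"
proof -
  obtain u where u: "u permutes {1..m}" "map u as = bs"
    using permutes_extend_list[OF _ assms(1-5)] by blast
  show ?thesis
  proof (cases "evenperm u")
    case True
    then show ?thesis using u by (auto simp: alt_group_carrier)
  next
    case False
    have "2 \<le> card ({1..m} - set bs)"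
      using assms(2,5,6) by (simp add: card_Diff_subset distinct_card)
    then obtain C where "C \<subseteq> {1..m} - set bs" "card C = 2" by (metis obtain_subset_with_card_n)
    then obtain c d where cd: "c \<noteq> d" "{c, d} \<subseteq> {1..m} - set bs" by (metis card_2_iff)
    have "permutation u" using u(1) permutes_imp_permutation by blast
    then have "evenperm (transpose c d \<circ> u)"
      using False cd by (simp add: evenperm_comp permutation_swap_id evenperm_swap)
    moreover have "transpose c d \<circ> u permutes {1..m}"
      using u(1) cd by (intro permutes_compose permutes_swap_id) auto
    moreover have "map (transpose c d \<circ> u) as = bs"
    proof -
      have "map (transpose c d \<circ> u) as = map (transpose c d) bs" using u(2) by auto
      also have "\<dots> = bs" using cd by (intro map_idI) (auto simp: transpose_def)
      finally show ?thesis .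
    qed
    ultimately show ?thesis by (intro bexI[of _ "transpose c d \<circ> u"]) (auto simp: alt_group_carrier)
  qed
qed

lemma permutes_free_subset:
  assumes "finite A" "x permutes A"
  shows "\<exists>S \<subseteq> moved x. S \<inter> x ` S = {} \<and> card (moved x) \<le> 3 * card S"
proof -
  have fin: "finite (moved x)" using assms finite_moved by blast
  have "inj x" "bij x" using assms permutes_inj permutes_bij by blast+
  define F where "F = {S. S \<subseteq> moved x \<and> S \<inter> x ` S = {}}"
  have "finite F" "{} \<in> F" using fin by (auto simp: F_def)
  then obtain S where S: "S \<in> F" "\<And>T. T \<in> F \<Longrightarrow> S \<subseteq> T \<Longrightarrow> T = S"
    using finite_has_maximal[of F] by blast
  have "moved x \<subseteq> S \<union> x ` S \<union> inv' x ` S"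
  proof
    fix z assume z: "z \<in> moved x"
    show "z \<in> S \<union> x ` S \<union> inv' x ` S"
    proof (rule ccontr)
      assume n: "z \<notin> S \<union> x ` S \<union> inv' x ` S"
      have "x z \<notin> S" using n \<open>inj x\<close> by (metis UnI2 image_eqI inv_f_f)
      moreover have "x z \<noteq> z" using z by (simp add: moved_def)
      ultimately have "insert z S \<in> F" using z n S(1) by (auto simp: F_def)
      then show False using S(2) n by blast
    qed
  qed
  moreover have finS: "finite S" using S(1) fin finite_subset by (auto simp: F_def)
  ultimately have "card (moved x) \<le> card (S \<union> x ` S \<union> inv' x ` S)"
    by (intro card_mono) auto
  also have "\<dots> \<le> card S + card (x ` S) + card (inv' x ` S)"
    by (meson add_le_mono card_Un_le le_trans order_refl)
  also have "\<dots> \<le> 3 * card S" using card_image_le[OF finS, of x] card_image_le[OF finS, of "inv' x"] by simp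
  finally show ?thesis using S(1) by (auto simp: F_def)
qed

text \<open>Split \<open>zs = ps @ qs\<close>. Some conjugate \<open>y\<close> of \<open>x\<close> maps the list \<open>ps\<close> to \<open>qs\<close>, and then
  \<open>swaps zs\<close> is the commutator of \<open>swaps ps\<close> and \<open>y\<close>.\<close>

lemma swaps_in_conj_quot:
  assumes x: "x permutes {1..m}" and k: "12 * k \<le> card (moved x)" "2 \<le> m"
    and zs: "distinct zs" "length zs = 8 * k" "set zs \<subseteq> {1..m}"
  shows "swaps zs \<in> conj_quot m x"
proof -
  have bx: "bij x" using x permutes_bij by blast
  obtain S where S: "S \<subseteq> moved x" "S \<inter> x ` S = {}" "card (moved x) \<le> 3 * card S"
    using permutes_free_subset[OF _ x] by blast
  then have "4 * k \<le> card S" using k by linarith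
  then obtain S' where S': "S' \<subseteq> S" "card S' = 4 * k" by (metis obtain_subset_with_card_n)
  have mx: "moved x \<subseteq> {1..m}" using x moved_permutes by blast
  then have "finite S'" using S'(1) S(1) by (meson finite_atLeastAtMost finite_subset)
  then obtain ss where ss: "distinct ss" "set ss = S'" "length ss = 4 * k"
    using S'(2) finite_distinct_list distinct_card by metis
  have "distinct (map x ss)" using ss(1) permutes_inj_on[OF x] by (simp add: distinct_map)
  moreover have "set ss \<inter> set (map x ss) = {}" using ss(2) S(2) S'(1) by auto
  ultimately have d: "distinct (ss @ map x ss)" using ss(1) by simp
  have "set (ss @ map x ss) \<subseteq> {1..m}"
    using ss(2) S(1) S'(1) mx permutes_image[OF x] by (auto 0 3)
  moreover have "length zs + 2 \<le> m"
  proof -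
    have "card (moved x) \<le> m" using card_mono[OF _ mx] by simp
    then show ?thesis using zs(2) k by (cases "k = 0") auto
  qed
  ultimately obtain u where u: "u \<in> carrier (alt_group m)" "map u (ss @ map x ss) = zs"
    using alt_extend_list[OF d zs(1) _ _ zs(3)] zs(2) ss(3) by auto
  define ps qs where "ps = map u ss" and "qs = map u (map x ss)"
  have zs_eq: "zs = ps @ qs" using u(2) by (simp add: ps_def qs_def)
  have bu: "bij u" using u(1) alt_bij by blast
  define y where "y = u \<circ> x \<circ> inv' u"
  have by': "bij y" unfolding y_def using bu bx by (intro bij_comp bij_imp_bij_inv)
  have "map y ps = qs" using bu by (simp add: y_def ps_def qs_def bij_is_inj)
  then have "y \<circ> swaps ps = swaps qs \<circ> y" using swaps_map[OF by', of ps] by simp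
  then have qs: "swaps qs = y \<circ> swaps ps \<circ> inv' y"
    using by' by (metis bij_is_surj comp_assoc comp_id surj_iff)
  have pp: "swaps ps \<circ> swaps ps = id" using zs(1) zs_eq swaps_swaps by auto
  then have inv_ps: "inv' (swaps ps) = swaps ps" by (metis inv_unique_comp)
  have "length ps = 4 * k" using ss by (simp add: ps_def)
  then have ps_alt: "swaps ps \<in> carrier (alt_group m)"
    using zs zs_eq evenperm_swaps[of ps] swaps_permutes[of ps "{1..m}"] by (simp add: alt_group_carrier)
  have "swaps zs = (swaps ps \<circ> y \<circ> inv' (swaps ps)) \<circ> inv' y"
    unfolding zs_eq using \<open>length ps = 4 * k\<close> by (simp add: swaps_append qs inv_ps comp_assoc)
  also have "\<dots> = ((swaps ps \<circ> u) \<circ> x \<circ> inv' (swaps ps \<circ> u)) \<circ> (u \<circ> inv' x \<circ> inv' u)"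
    unfolding y_def using bu bx alt_bij[OF ps_alt] by (simp only: conj_conj inv_conj)
  finally show ?thesis using conj_quotI[OF alt_comp[OF ps_alt u(1)] u(1)] by metis
qed

lemma obtain_fresh_list:
  assumes "finite A" "set zs \<subseteq> A" "length zs + n \<le> card A"
  obtains ws where "distinct ws" "length ws = n" "set ws \<subseteq> A" "set ws \<inter> set zs = {}"
proof -
  have "n \<le> card (A - set zs)"
    using assms card_Diff_subset[of "set zs" A] card_length[of zs] by simp
  then obtain W where W: "W \<subseteq> A - set zs" "card W = n" by (metis obtain_subset_with_card_n)
  moreover have "finite W" using W(1) assms(1) finite_subset by blast
  ultimately obtain ws where "distinct ws" "set ws = W" "length ws = n"
    using finite_distinct_list distinct_card by metis
  with W(1) that show ?thesis by blast
qed

lemma swaps_four: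
  assumes y: "y permutes {1..m}" "12 \<le> card (moved y)" and m: "10 \<le> m"
    and zs: "distinct zs" "length zs = 4" "set zs \<subseteq> {1..m}"
  shows "swaps zs \<in> conj_quots m y 2"
proof -
  obtain ws where ws: "distinct ws" "length ws = 6" "set ws \<subseteq> {1..m}" "set ws \<inter> set zs = {}"
    using obtain_fresh_list[OF _ zs(3), of 6] zs(2) m by auto
  obtain as bs where ab: "zs = as @ bs" "length as = 2" "length bs = 2"
    using zs(2) by (intro that[of "take 2 zs" "drop 2 zs"]) auto
  have "swaps (as @ ws) \<in> conj_quot m y"
    by (rule swaps_in_conj_quot[OF y(1), of 1]) (use zs ws ab y m in auto)
  moreover have "swaps (ws @ bs) \<in> conj_quot m y"
    by (rule swaps_in_conj_quot[OF y(1), of 1]) (use zs ws ab y m in auto)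
  ultimately have "swaps (as @ ws) \<circ> swaps (ws @ bs) \<in> conj_quots m y (Suc 0 + Suc 0)"
    by (intro conj_quots_comp) (simp_all only: conj_quots_1)
  moreover have "swaps (as @ ws) \<circ> swaps (ws @ bs) = swaps zs"
  proof -
    have "swaps (as @ ws) \<circ> swaps (ws @ bs) = swaps as \<circ> ((swaps ws \<circ> swaps ws) \<circ> swaps bs)"
      using ws ab by (simp only: swaps_append even_numeral comp_assoc)
    also have "\<dots> = swaps as \<circ> swaps bs" using swaps_swaps[OF ws(1)] by (simp only: id_comp)
    also have "\<dots> = swaps (as @ bs)" using ab by (simp only: swaps_append even_numeral)
    finally show ?thesis unfolding ab(1) .
  qed
  ultimately show ?thesis by (simp only: numeral_2_eq_2 add_Suc add_0)
qed

lemma swaps_chunk: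
  assumes y: "y permutes {1..m}" "12 \<le> card (moved y)" and m: "10 \<le> m"
    and zs: "distinct zs" "length zs = 4 * j" "set zs \<subseteq> {1..m}" "4 * j \<le> 8 * (card (moved y) div 12)"
  shows "swaps zs \<in> conj_quots m y 3"
proof (cases "even j")
  case True
  then obtain k where "j = 2 * k" by blast
  then have "swaps zs \<in> conj_quots m y 1"
    unfolding One_nat_def conj_quots_1 using assms by (intro swaps_in_conj_quot[where k = k]) auto
  then show ?thesis using conj_quots_mono[of y 1 3 m] permutes_bij[OF y(1)] by auto
next
  case False
  then obtain k where k: "j = 2 * k + 1" by (blast elim: oddE)
  let ?as = "take 4 zs" and ?bs = "drop 4 zs"
  have *: "set ?as \<subseteq> {1..m}" "set ?bs \<subseteq> {1..m}" "length ?as = 4" "length ?bs = 8 * k"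
    using zs k set_take_subset[of 4 zs] set_drop_subset[of 4 zs] by auto
  have "swaps ?as \<in> conj_quots m y 2"
    using y m zs * by (intro swaps_four) auto
  moreover have "swaps ?bs \<in> conj_quots m y 1"
    unfolding One_nat_def conj_quots_1
    using assms k * by (intro swaps_in_conj_quot[where k = k]) auto
  ultimately have "swaps ?as \<circ> swaps ?bs \<in> conj_quots m y (2 + 1)" by (rule conj_quots_comp)
  moreover have "swaps ?as \<circ> swaps ?bs = swaps zs"
    using swaps_append[of ?as ?bs] * by (simp only: append_take_drop_id even_numeral)
  ultimately show ?thesis by simp
qed

lemma swaps_chunks:
  assumes y: "y permutes {1..m}" "12 \<le> card (moved y)" and m: "10 \<le> m"
    and zs: "distinct zs" "length zs = 4 * j" "set zs \<subseteq> {1..m}" "4 * j \<le> 8 * (card (moved y) div 12) * n"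
  shows "swaps zs \<in> conj_quots m y (3 * n)"
  using zs
proof (induction n arbitrary: zs j)
  case (Suc n)
  let ?q = "card (moved y) div 12"
  show ?case
  proof (cases "4 * j \<le> 8 * ?q")
    case True
    then have "swaps zs \<in> conj_quots m y 3" using swaps_chunk[OF y m] Suc by blast
    then show ?thesis using conj_quots_mono[of y 3 "3 * Suc n" m] permutes_bij[OF y(1)] by auto
  next
    case False
    let ?as = "take (8 * ?q) zs" and ?bs = "drop (8 * ?q) zs"
    have *: "set ?as \<subseteq> {1..m}" "set ?bs \<subseteq> {1..m}" "length ?as = 4 * (2 * ?q)" "length ?bs = 4 * (j - 2 * ?q)"
      using Suc.prems False set_take_subset[of "8 * ?q" zs] set_drop_subset[of "8 * ?q" zs] by auto
    have "swaps ?as \<in> conj_quots m y 3"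
      using Suc.prems * by (intro swaps_chunk[OF y m _ *(3)]) auto
    moreover have "swaps ?bs \<in> conj_quots m y (3 * n)"
      using Suc.prems * False by (intro Suc.IH[OF _ *(4)]) (auto simp: algebra_simps)
    ultimately have "swaps ?as \<circ> swaps ?bs \<in> conj_quots m y (3 + 3 * n)" by (rule conj_quots_comp)
    moreover have "swaps ?as \<circ> swaps ?bs = swaps zs"
      using swaps_append[of ?as ?bs] * by (simp only: append_take_drop_id even_mult_iff even_numeral simp_thms)
    ultimately show ?thesis by (simp only: mult_Suc_right)
  qed
qed (auto simp: permutes_id)

lemma even_permutation_in_conj_quots:
  assumes y: "y permutes {1..m}" "12 \<le> card (moved y)" and m: "10 \<le> m"
    and e: "e \<in> carrier (alt_group m)" "card (moved e) \<le> 8 * (card (moved y) div 12) * n"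
  shows "e \<in> conj_quots m y (6 * n + 4)"
proof -
  have ep: "e permutes {1..m}" "evenperm e" using e(1) alt_group_carrier by auto
  have fin: "finite (moved e)" and me: "moved e \<subseteq> {1..m}"
    using ep(1) finite_moved moved_permutes by blast+
  have by': "bij y" using y(1) permutes_bij by blast
  obtain i j where ij: "i \<circ> i = id" "j \<circ> j = id" "moved i \<subseteq> moved e" "moved j \<subseteq> moved e" "e = i \<circ> j"
    using permutation_two_involutions[OF _ ep(1)] by blast
  obtain as where as: "distinct as" "even (length as)" "set as = moved i" "i = swaps as"
    using involution_eq_swaps[OF finite_subset[OF ij(3) fin] ij(1)] by blast
  obtain bs where bs: "distinct bs" "even (length bs)" "set bs = moved j" "j = swaps bs"
    using involution_eq_swaps[OF finite_subset[OF ij(4) fin] ij(2)] by blast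
  have len: "length as \<le> card (moved e)" "length bs \<le> card (moved e)"
    using as(1,3) bs(1,3) ij(3,4) card_mono[OF fin] distinct_card by metis+
  have sub: "set as \<subseteq> {1..m}" "set bs \<subseteq> {1..m}" using as(3) bs(3) ij(3,4) me by auto
  have par: "even (length as div 2) \<longleftrightarrow> even (length bs div 2)"
    using ep(2) evenperm_comp[OF swaps_permutation swaps_permutation, of as bs]
      evenperm_swaps as(1,4) bs(1,4) ij(5) by metis
  show ?thesis
  proof (cases "even (length as div 2)")
    case True
    have parts: "\<exists>a. length zs = 4 * a" if "even (length zs)" "even (length zs div 2)" for zs :: "nat list"
      using that by presburger
    obtain a b where ab: "length as = 4 * a" "length bs = 4 * b"
      using parts[of as] parts[of bs] True par as(2) bs(2) by auto
    have "i \<in> conj_quots m y (3 * n)"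
      unfolding as(4) by (rule swaps_chunks[OF y m as(1) ab(1) sub(1)]) (use ab len e(2) in linarith)
    moreover have "j \<in> conj_quots m y (3 * n)"
      unfolding bs(4) by (rule swaps_chunks[OF y m bs(1) ab(2) sub(2)]) (use ab len e(2) in linarith)
    ultimately have "e \<in> conj_quots m y (3 * n + 3 * n)" unfolding ij(5) by (rule conj_quots_comp)
    then show ?thesis using conj_quots_mono[OF by', of "3 * n + 3 * n" "6 * n + 4"] by auto
  next
    case False
    have parts: "\<exists>a. length zs = 4 * a + 2" if "even (length zs)" "odd (length zs div 2)" for zs :: "nat list"
      using that by presburger
    obtain a b where ab: "length as = 4 * a + 2" "length bs = 4 * b + 2"
      using parts[of as] parts[of bs] False par as(2) bs(2) by auto
    define as' as2 bs2 bs' where "as' = take (4 * a) as" and "as2 = drop (4 * a) as"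
      and "bs2 = take 2 bs" and "bs' = drop 2 bs"
    have l: "length as' = 4 * a" "length as2 = 2" "length bs2 = 2" "length bs' = 4 * b"
      using ab by (auto simp: as'_def bs'_def as2_def bs2_def)
    have d: "distinct as'" "distinct as2" "distinct bs'" "distinct bs2"
      using as(1) bs(1) by (auto simp: as'_def bs'_def as2_def bs2_def)
    have s: "set as' \<subseteq> {1..m}" "set as2 \<subseteq> {1..m}" "set bs' \<subseteq> {1..m}" "set bs2 \<subseteq> {1..m}"
      using sub set_take_subset set_drop_subset unfolding as'_def bs'_def as2_def bs2_def by fast+
    obtain cs where cs: "distinct cs" "length cs = 2" "set cs \<subseteq> {1..m}" "set cs \<inter> set (as2 @ bs2) = {}"
      using obtain_fresh_list[of "{1..m}" "as2 @ bs2" 2] s l m by auto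
    have "swaps as' \<in> conj_quots m y (3 * n)"
      by (rule swaps_chunks[OF y m d(1) l(1) s(1)]) (use ab len e(2) in linarith)
    moreover have "swaps bs' \<in> conj_quots m y (3 * n)"
      by (rule swaps_chunks[OF y m d(3) l(4) s(3)]) (use ab len e(2) in linarith)
    moreover have "swaps (as2 @ cs) \<in> conj_quots m y 2"
      by (rule swaps_four[OF y m]) (use l d s cs in auto)
    moreover have "swaps (cs @ bs2) \<in> conj_quots m y 2"
      by (rule swaps_four[OF y m]) (use l d s cs in auto)
    ultimately have "swaps as' \<circ> (swaps (as2 @ cs) \<circ> (swaps (cs @ bs2) \<circ> swaps bs'))
        \<in> conj_quots m y (3 * n + (2 + (2 + 3 * n)))"
      by (intro conj_quots_comp)
    moreover have "swaps as' \<circ> (swaps (as2 @ cs) \<circ> (swaps (cs @ bs2) \<circ> swaps bs')) = e"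
    proof -
      have "swaps as' \<circ> (swaps (as2 @ cs) \<circ> (swaps (cs @ bs2) \<circ> swaps bs'))
          = (swaps as' \<circ> swaps as2) \<circ> ((swaps cs \<circ> swaps cs) \<circ> (swaps bs2 \<circ> swaps bs'))"
        using l cs by (simp only: swaps_append even_numeral comp_assoc)
      also have "\<dots> = (swaps as' \<circ> swaps as2) \<circ> (swaps bs2 \<circ> swaps bs')"
        using swaps_swaps[OF cs(1)] by (simp only: id_comp)
      also have "\<dots> = swaps (as' @ as2) \<circ> swaps (bs2 @ bs')"
        using l by (simp only: swaps_append even_mult_iff even_numeral simp_thms)
      finally show ?thesis unfolding as'_def as2_def bs'_def bs2_def ij(5) as(4) bs(4)
        by (simp only: append_take_drop_id)
    qed
    moreover have "3 * n + (2 + (2 + 3 * n)) = 6 * n + 4" by simp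
    ultimately show ?thesis by metis
  qed
qed

lemma conj_quot_double:
  assumes x: "x permutes {1..m}" and c: "2 * card (moved x) \<le> m" "card (moved x) + 2 \<le> m"
  shows "\<exists>y. y permutes {1..m} \<and> y \<in> conj_quot m x \<and> card (moved y) = 2 * card (moved x)"
proof -
  have bx: "bij x" using x permutes_bij by blast
  have fin: "finite (moved x)" and sub: "moved x \<subseteq> {1..m}" using x finite_moved moved_permutes by blast+
  obtain as where as: "distinct as" "set as = moved x" "length as = card (moved x)"
    using fin finite_distinct_list distinct_card by metis
  obtain bs where bs: "distinct bs" "length bs = card (moved x)" "set bs \<subseteq> {1..m}" "set bs \<inter> set as = {}"
    using obtain_fresh_list[of "{1..m}" as "card (moved x)"] as sub c by auto
  obtain u where u: "u \<in> carrier (alt_group m)" "map u as = bs"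
    using alt_extend_list[OF as(1) bs(1) _ _ bs(3)] as bs sub c by auto
  have bu: "bij u" using u(1) alt_bij by blast
  define w where "w = u \<circ> x \<circ> inv' u"
  have up: "u permutes {1..m}" using u(1) alt_group_carrier by blast
  have wp: "w permutes {1..m}"
    unfolding w_def by (intro permutes_compose permutes_inv up x)
  have mw: "moved w = set bs" unfolding w_def moved_conj[OF bu] using u(2) as(2) by auto
  have mi: "moved (inv' x) = moved x" using bx moved_inv by blast
  have disj: "moved w \<inter> moved (inv' x) = {}" using mw mi bs(4) as(2) by auto
  have "moved (w \<circ> inv' x) = moved w \<union> moved (inv' x)"
  proof
    show "moved w \<union> moved (inv' x) \<subseteq> moved (w \<circ> inv' x)"
    proof
      fix z assume z: "z \<in> moved w \<union> moved (inv' x)"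
      show "z \<in> moved (w \<circ> inv' x)"
      proof (cases "z \<in> moved w")
        case True
        then have "inv' x z = z" using disj by (auto simp: moved_def)
        then show ?thesis using True by (simp add: moved_def)
      next
        case False
        then have "inv' x z \<noteq> z" "z \<in> moved x" using z mi by (auto simp: moved_def)
        then have "inv' x z \<in> moved (inv' x)"
          using bx unfolding moved_def mem_Collect_eq by (metis bij_inv_eq_iff)
        then have "w (inv' x z) = inv' x z" using disj by (auto simp: moved_def)
        then show ?thesis using \<open>inv' x z \<noteq> z\<close> by (simp add: moved_def)
      qed
    qed
  qed (rule moved_comp)
  then have "card (moved (w \<circ> inv' x)) = card (set bs) + card (moved x)"
    using disj fin mi mw by (simp add: card_Un_disjoint)
  then have "card (moved (w \<circ> inv' x)) = 2 * card (moved x)"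
    using bs distinct_card by fastforce
  moreover have "w \<circ> inv' x permutes {1..m}" by (intro permutes_compose permutes_inv x wp)
  moreover have "w \<circ> inv' x \<in> conj_quot m x"
    using conj_quotI[OF u(1) id_in_alt, of x] unfolding w_def inv_id comp_id id_comp .
  ultimately show ?thesis by blast
qed

lemma conj_quots_boost:
  assumes "24 \<le> m" "x permutes {1..m}" "12 \<le> card (moved x) * 2 ^ j"
  shows "\<exists>y. y permutes {1..m} \<and> 12 \<le> card (moved y) \<and> card (moved x) \<le> card (moved y) \<and>
           (\<forall>k. conj_quots m y k \<subseteq> conj_quots m x (2 ^ j * k))"
  using assms(2,3)
proof (induction j arbitrary: x)
  case 0
  then show ?case by (intro exI[of _ x]) auto
next
  case (Suc j)
  have bx: "bij x" using Suc.prems(1) permutes_bij by blast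
  show ?case
  proof (cases "12 \<le> card (moved x)")
    case True
    have "conj_quots m x k \<subseteq> conj_quots m x (2 ^ Suc j * k)" for k
      by (rule conj_quots_mono[OF bx]) simp
    then show ?thesis using True Suc.prems(1) by blast
  next
    case False
    then obtain w where w: "w permutes {1..m}" "w \<in> conj_quot m x" "card (moved w) = 2 * card (moved x)"
      using conj_quot_double[OF Suc.prems(1)] assms(1) by auto
    then obtain y where y: "y permutes {1..m}" "12 \<le> card (moved y)" "card (moved w) \<le> card (moved y)"
      "\<And>k. conj_quots m y k \<subseteq> conj_quots m w (2 ^ j * k)"
      using Suc.IH[OF w(1)] Suc.prems(2) by auto
    have "conj_quots m y k \<subseteq> conj_quots m x (2 ^ Suc j * k)" for k
      using y(4)[of k] conj_quots_trans[OF bx permutes_bij[OF w(1)] w(2), of "2 ^ j * k"]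
      by (simp add: mult.assoc)
    then show ?thesis using y w(3) by (intro exI[of _ y]) auto
  qed
qed

lemma alt_in_conj_quots:
  assumes m: "24 \<le> m" and x: "x permutes {1..m}"
    and e: "e \<in> carrier (alt_group m)" "card (moved e) \<le> c * card (moved x)"
  shows "e \<in> conj_quots m x (16 * (18 * c + 4))"
proof (cases "moved x = {}")
  case True
  have "finite (moved e)" using e(1) alt_group_carrier finite_moved by blast
  then have "e = id" using True e(2) moved_eq_empty by fastforce
  then show ?thesis using id_in_conj_quots permutes_bij[OF x] by blast
next
  case False
  then have "1 \<le> card (moved x)" using finite_moved[OF x] by (simp add: Suc_leI card_gt_0_iff)
  then have "12 \<le> card (moved x) * 2 ^ 4" by simp
  then obtain y where y: "y permutes {1..m}" "12 \<le> card (moved y)" "card (moved x) \<le> card (moved y)"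
    "\<And>k. conj_quots m y k \<subseteq> conj_quots m x (2 ^ 4 * k)"
    using conj_quots_boost[OF m x] by blast
  have "card (moved y) \<le> 24 * (card (moved y) div 12)" using y(2) by presburger
  then have "c * card (moved x) \<le> c * (24 * (card (moved y) div 12))"
    using y(3) by (meson le_trans mult_le_mono2)
  then have "card (moved e) \<le> 8 * (card (moved y) div 12) * (3 * c)"
    using e(2) by (simp only: mult_ac)
  then have "e \<in> conj_quots m y (6 * (3 * c) + 4)"
    using m by (intro even_permutation_in_conj_quots[OF y(1,2) _ e(1)]) auto
  then show ?thesis using y(4)[of "6 * (3 * c) + 4"] by auto
qed

section \<open>Almost homomorphisms into symmetric groups\<close>

definition perm_model :: "('b, 'c) monoid_scheme \<Rightarrow> 'b set \<Rightarrow> 'd set \<Rightarrow> ('b \<Rightarrow> 'd \<Rightarrow> 'd) \<Rightarrow> nat \<Rightarrow> bool" where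
  "perm_model G \<Phi> \<Omega> \<psi> D \<longleftrightarrow>
     (\<forall>a\<in>\<Phi>. \<psi> a permutes \<Omega>) \<and> (\<one>\<^bsub>G\<^esub> \<in> \<Phi> \<longrightarrow> \<psi> \<one>\<^bsub>G\<^esub> = id) \<and>
     (\<forall>a\<in>\<Phi>. \<forall>b\<in>\<Phi>. a \<otimes>\<^bsub>G\<^esub> b \<in> \<Phi> \<longrightarrow> card {z\<in>\<Omega>. \<psi> a (\<psi> b z) \<noteq> \<psi> (a \<otimes>\<^bsub>G\<^esub> b) z} \<le> D)"

lemma card_moved_comp_inv:
  assumes "q permutes \<Omega>" "p permutes \<Omega>"
  shows "card (moved (p \<circ> inv' q)) = card {z\<in>\<Omega>. p z \<noteq> q z}"
proof -
  have b: "bij q" using assms permutes_bij by blast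
  have "moved (p \<circ> inv' q) = q ` {z. p z \<noteq> q z}"
  proof (rule Set.set_eqI)
    fix z
    obtain y where z: "z = q y" using b by (metis bij_pointE)
    have "inj q" using b by (rule bij_is_inj)
    then show "z \<in> moved (p \<circ> inv' q) \<longleftrightarrow> z \<in> q ` {z. p z \<noteq> q z}"
      by (simp add: z moved_def inj_image_mem_iff)
  qed
  moreover have "{z. p z \<noteq> q z} = {z\<in>\<Omega>. p z \<noteq> q z}"
  proof -
    have "z \<in> \<Omega>" if "p z \<noteq> q z" for z
      using that permutes_not_in[OF assms(1), of z] permutes_not_in[OF assms(2), of z] by metis
    then show ?thesis by blast
  qed
  ultimately show ?thesis using card_image[of q] permutes_inj_on[OF assms(1)] by metis
qed

lemma card_moved_ge_2:
  assumes "finite \<Omega>" "p permutes \<Omega>" "p \<noteq> id"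
  shows "2 \<le> card (moved p)"
proof -
  obtain z where z: "p z \<noteq> z" using assms(3) by (auto simp: fun_eq_iff)
  then have "p (p z) \<noteq> p z" using permutes_inj[OF assms(2)] by (simp add: inj_eq)
  then have "{z, p z} \<subseteq> moved p" using z by (simp add: moved_def)
  moreover have "card {z, p z} = 2" using z by simp
  ultimately show ?thesis using card_mono[OF finite_moved[OF assms(2,1)]] by metis
qed

lemma perm_model_transport:
  assumes "finite \<Omega>" "perm_model G \<Phi> \<Omega> \<psi> D"
  shows "\<exists>\<psi>'. perm_model G \<Phi> {1..card \<Omega>} \<psi>' D \<and> (\<forall>a\<in>\<Phi>. card (moved (\<psi>' a)) = card (moved (\<psi> a)))"
proof -
  obtain f where f: "bij_betw f \<Omega> {1..card \<Omega>}"
    using ex_bij_betw_finite_nat[OF assms(1)] assms(1)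
    by (metis bij_betw_iff_card card_atLeastAtMost diff_Suc_1 finite_atLeastAtMost)
  have fi: "inj_on f \<Omega>" and fim: "f ` \<Omega> = {1..card \<Omega>}" using f by (auto simp: bij_betw_def)
  define \<psi>' where "\<psi>' a = map_permutation \<Omega> f (\<psi> a)" for a
  have perm: "\<psi> a permutes \<Omega>" if "a \<in> \<Phi>" for a using that assms(2) by (simp add: perm_model_def)
  have perm': "\<psi>' a permutes {1..card \<Omega>}" if "a \<in> \<Phi>" for a
    unfolding \<psi>'_def using map_permutation_permutes[OF f perm[OF that]] .
  have ap: "\<psi>' a (f z) = f (\<psi> a z)" "\<psi> a z \<in> \<Omega>" if "a \<in> \<Phi>" "z \<in> \<Omega>" for a z
    using map_permutation_apply[OF fi that(2), of "\<psi> a"] permutes_in_image[OF perm[OF that(1)]] that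
    by (simp_all add: \<psi>'_def)
  have ff: "f y = f z \<longleftrightarrow> y = z" if "y \<in> \<Omega>" "z \<in> \<Omega>" for y z using fi that by (auto simp: inj_on_def)
  have "\<psi>' \<one>\<^bsub>G\<^esub> = id" if "\<one>\<^bsub>G\<^esub> \<in> \<Phi>"
    using that assms(2) map_permutation_id'[OF fi] by (simp add: perm_model_def \<psi>'_def)
  moreover have "card {z\<in>{1..card \<Omega>}. \<psi>' a (\<psi>' b z) \<noteq> \<psi>' (a \<otimes>\<^bsub>G\<^esub> b) z} \<le> D"
    if "a \<in> \<Phi>" "b \<in> \<Phi>" "a \<otimes>\<^bsub>G\<^esub> b \<in> \<Phi>" for a b
  proof -
    have "{z\<in>{1..card \<Omega>}. \<psi>' a (\<psi>' b z) \<noteq> \<psi>' (a \<otimes>\<^bsub>G\<^esub> b) z}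
        = f ` {z\<in>\<Omega>. \<psi> a (\<psi> b z) \<noteq> \<psi> (a \<otimes>\<^bsub>G\<^esub> b) z}"
      unfolding fim[symmetric] using that by (auto simp: ap ff)
    also have "card \<dots> = card {z\<in>\<Omega>. \<psi> a (\<psi> b z) \<noteq> \<psi> (a \<otimes>\<^bsub>G\<^esub> b) z}"
      by (rule card_image) (rule inj_on_subset[OF fi], blast)
    finally show ?thesis using assms(2) that by (simp add: perm_model_def)
  qed
  ultimately have "perm_model G \<Phi> {1..card \<Omega>} \<psi>' D" using perm' by (simp add: perm_model_def)
  moreover have "card (moved (\<psi>' a)) = card (moved (\<psi> a))" if "a \<in> \<Phi>" for a
  proof -
    have "moved (\<psi>' a) = {z \<in> f ` \<Omega>. \<psi>' a z \<noteq> z}"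
      using moved_permutes[OF perm'[OF that]] unfolding fim by (auto simp: moved_def)
    also have "\<dots> = f ` moved (\<psi> a)"
      using that moved_permutes[OF perm[OF that]] by (auto simp: ap ff moved_def)
    finally show ?thesis
      using card_image inj_on_subset[OF fi moved_permutes[OF perm[OF that]]] by metis
  qed
  ultimately show ?thesis by blast
qed

lemma perm_model_copies:
  fixes \<Omega> :: "'i \<Rightarrow> 'd set" and k :: "'i \<Rightarrow> nat"
  assumes "finite I" "\<And>g. g \<in> I \<Longrightarrow> finite (\<Omega> g)"
    and "\<And>g. g \<in> I \<Longrightarrow> perm_model G \<Phi> (\<Omega> g) (\<psi> g) (D g)"
  shows "\<exists>(M :: nat) \<psi>'. perm_model G \<Phi> {1..M} \<psi>' (\<Sum>g\<in>I. k g * D g) \<and>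
           (\<forall>a\<in>\<Phi>. \<forall>g\<in>I. k g * card (moved (\<psi> g a)) \<le> card (moved (\<psi>' a)))"
proof -
  define \<Omega>' where "\<Omega>' = (SIGMA g:I. {..<k g} \<times> \<Omega> g)"
  define \<psi>' where "\<psi>' a w = (if w \<in> \<Omega>' then (fst w, fst (snd w), \<psi> (fst w) a (snd (snd w))) else w)" for a w
  have perm: "\<psi> g a permutes \<Omega> g" if "g \<in> I" "a \<in> \<Phi>" for g a
    using assms(3)[OF that(1)] that(2) by (simp add: perm_model_def)
  have fin: "finite \<Omega>'" unfolding \<Omega>'_def using assms(1,2) by auto
  have mem: "(g, j, z) \<in> \<Omega>' \<longleftrightarrow> g \<in> I \<and> j < k g \<and> z \<in> \<Omega> g" for g j z
    by (auto simp: \<Omega>'_def)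
  have ap: "\<psi>' a (g, j, z) = (g, j, \<psi> g a z)" if "(g, j, z) \<in> \<Omega>'" for g j z a
    using that by (simp add: \<psi>'_def)
  have into: "(g, j, \<psi> g a z) \<in> \<Omega>'" if "(g, j, z) \<in> \<Omega>'" "a \<in> \<Phi>" for g j z a
    using that perm[of g a] by (auto simp: mem permutes_in_image)
  have perm': "\<psi>' a permutes \<Omega>'" if a: "a \<in> \<Phi>" for a
  proof (rule bij_imp_permutes)
    have "inj_on (\<psi>' a) \<Omega>'"
    proof (rule inj_onI)
      fix v v' assume v: "v \<in> \<Omega>'" "v' \<in> \<Omega>'" "\<psi>' a v = \<psi>' a v'"
      obtain g j z g' j' z' where vv: "v = (g, j, z)" "v' = (g', j', z')" by (metis prod_cases3)
      note w = v[unfolded vv]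
      then have eq: "g = g'" "j = j'" "\<psi> g a z = \<psi> g a z'" using ap by auto
      have "g \<in> I" using w(1) mem by blast
      then have "inj (\<psi> g a)" using perm[OF _ a] permutes_inj by blast
      then show "v = v'" using eq vv by (auto dest: injD)
    qed
    moreover have "\<psi>' a ` \<Omega>' \<subseteq> \<Omega>'" using into[OF _ a] by (auto simp: ap)
    ultimately show "bij_betw (\<psi>' a) \<Omega>' \<Omega>'"
      using endo_inj_surj[OF fin] by (simp add: bij_betw_def)
  qed (simp add: \<psi>'_def)
  have card_Om: "card {w\<in>\<Omega>'. P w} = (\<Sum>g\<in>I. k g * card {z\<in>\<Omega> g. Q g z})"
    if "\<And>g j z. (g, j, z) \<in> \<Omega>' \<Longrightarrow> P (g, j, z) \<longleftrightarrow> Q g z" for P Q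
  proof -
    have "{w\<in>\<Omega>'. P w} = (SIGMA g:I. {..<k g} \<times> {z\<in>\<Omega> g. Q g z})"
      using that by (auto simp: mem)
    also have "card \<dots> = (\<Sum>g\<in>I. card ({..<k g} \<times> {z\<in>\<Omega> g. Q g z}))"
      by (rule card_SigmaI) (use assms(1,2) in auto)
    finally show ?thesis by (simp add: card_cartesian_product)
  qed
  have "perm_model G \<Phi> \<Omega>' \<psi>' (\<Sum>g\<in>I. k g * D g)"
    unfolding perm_model_def
  proof (intro conjI ballI impI perm')
    assume one: "\<one>\<^bsub>G\<^esub> \<in> \<Phi>"
    have "\<psi> g \<one>\<^bsub>G\<^esub> = id" if "g \<in> I" for g using assms(3)[OF that] one by (simp add: perm_model_def)
    then show "\<psi>' \<one>\<^bsub>G\<^esub> = id" by (auto simp: fun_eq_iff \<psi>'_def mem)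
  next
    fix a b assume ab: "a \<in> \<Phi>" "b \<in> \<Phi>" "a \<otimes>\<^bsub>G\<^esub> b \<in> \<Phi>"
    have "card {w\<in>\<Omega>'. \<psi>' a (\<psi>' b w) \<noteq> \<psi>' (a \<otimes>\<^bsub>G\<^esub> b) w}
        = (\<Sum>g\<in>I. k g * card {z\<in>\<Omega> g. \<psi> g a (\<psi> g b z) \<noteq> \<psi> g (a \<otimes>\<^bsub>G\<^esub> b) z})"
      by (rule card_Om) (simp add: ap into ab)
    also have "\<dots> \<le> (\<Sum>g\<in>I. k g * D g)"
      using assms(3) ab by (intro sum_mono mult_le_mono2) (simp add: perm_model_def)
    finally show "card {w\<in>\<Omega>'. \<psi>' a (\<psi>' b w) \<noteq> \<psi>' (a \<otimes>\<^bsub>G\<^esub> b) w} \<le> (\<Sum>g\<in>I. k g * D g)" .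
  qed
  from perm_model_transport[OF fin this] obtain \<psi>'' where
    "perm_model G \<Phi> {1..card \<Omega>'} \<psi>'' (\<Sum>g\<in>I. k g * D g)" and
    card'': "\<And>a. a \<in> \<Phi> \<Longrightarrow> card (moved (\<psi>'' a)) = card (moved (\<psi>' a))" by blast
  moreover have "k g * card (moved (\<psi> g a)) \<le> card (moved (\<psi>'' a))" if "a \<in> \<Phi>" "g \<in> I" for a g
  proof -
    have restr: "moved p = {z\<in>A. p z \<noteq> z}" if "p permutes A" for p :: "'e \<Rightarrow> 'e" and A
      using moved_permutes[OF that] by (auto simp: moved_def)
    have "card (moved (\<psi>' a)) = (\<Sum>g\<in>I. k g * card {z\<in>\<Omega> g. \<psi> g a z \<noteq> z})"
      unfolding restr[OF perm'[OF that(1)]] by (rule card_Om) (simp add: ap)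
    also have "\<dots> = (\<Sum>g\<in>I. k g * card (moved (\<psi> g a)))"
      using restr[OF perm] that(1) by (intro sum.cong) auto
    also have "\<dots> \<ge> k g * card (moved (\<psi> g a))"
      using assms(1) that(2) by (intro member_le_sum) auto
    finally show ?thesis using card''[OF that(1)] by simp
  qed
  ultimately show ?thesis by blast
qed

text \<open>With \<open>s g\<close> the number of points moved by \<open>\<psi> g g\<close>, taking \<open>\<Prod>h\<noteq>g. s h\<close> copies of the
  \<open>g\<close>-th model makes the number of points of its copies moved by \<open>g\<close> independent of \<open>g\<close>.\<close>

lemma perm_model_combine:
  fixes \<psi> :: "'b \<Rightarrow> 'b \<Rightarrow> nat \<Rightarrow> nat" and m :: "'b \<Rightarrow> nat"
  assumes "finite I" "I \<subseteq> \<Phi>"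
    and model: "\<And>g. g \<in> I \<Longrightarrow> perm_model G \<Phi> {1..m g} (\<psi> g) (D g)"
    and big: "\<And>g. g \<in> I \<Longrightarrow> (n * card I + 1) * D g < card (moved (\<psi> g g))"
  shows "\<exists>(M :: nat) \<psi>' D'. perm_model G \<Phi> {1..M} \<psi>' D' \<and> (\<forall>g\<in>I. n * D' < card (moved (\<psi>' g)))"
proof -
  define s where "s g = card (moved (\<psi> g g))" for g
  define k where "k g = (\<Prod>h\<in>I - {g}. s h)" for g
  define Q where "Q = (\<Prod>h\<in>I. s h)"
  define D' where "D' = (\<Sum>g\<in>I. k g * D g)"
  have kQ: "k g * s g = Q" if "g \<in> I" for g
    using prod.remove[OF assms(1) that, of s] by (simp add: k_def Q_def mult.commute)
  have "Q > 0" unfolding Q_def using big by (intro prod_pos) (auto simp: s_def intro: le_less_trans)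
  have "(n * card I + 1) * D' = (\<Sum>g\<in>I. k g * ((n * card I + 1) * D g))"
    unfolding D'_def sum_distrib_left by (intro sum.cong) (simp_all only: mult_ac)
  also have "\<dots> \<le> (\<Sum>g\<in>I. k g * s g)"
    using big by (intro sum_mono mult_le_mono2) (simp add: s_def less_imp_le)
  also have "\<dots> = card I * Q" using kQ by simp
  finally have le: "(n * card I + 1) * D' \<le> card I * Q" .
  have "n * D' < Q"
  proof (cases "D' = 0")
    case False
    then have "card I * (n * D') < (n * card I + 1) * D'" by (simp add: algebra_simps)
    then have "card I * (n * D') < card I * Q" using le by (rule less_le_trans)
    then show ?thesis using nat_mult_less_cancel_disj by blast
  qed (use \<open>Q > 0\<close> in simp)
  moreover have "\<exists>(M :: nat) \<psi>'. perm_model G \<Phi> {1..M} \<psi>' D' \<and>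
      (\<forall>a\<in>\<Phi>. \<forall>g\<in>I. k g * card (moved (\<psi> g a)) \<le> card (moved (\<psi>' a)))"
    unfolding D'_def by (rule perm_model_copies[OF assms(1) _ model]) auto
  then obtain M :: nat and \<psi>' where "perm_model G \<Phi> {1..M} \<psi>' D'" and
    copies: "\<forall>a\<in>\<Phi>. \<forall>g\<in>I. k g * card (moved (\<psi> g a)) \<le> card (moved (\<psi>' a))" by blast
  moreover have "Q \<le> card (moved (\<psi>' g))" if "g \<in> I" for g
    using copies that assms(2) kQ[OF that] by (metis s_def subsetD)
  ultimately show ?thesis by (meson less_le_trans)
qed

lemma perm_model_even:
  fixes M :: nat
  assumes "perm_model G \<Phi> {1..M} \<psi> D"
  shows "\<exists>\<psi>'. perm_model G \<Phi> {1..M + 2} \<psi>' (2 * D) \<and>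
           (\<forall>a\<in>\<Phi>. evenperm (\<psi>' a) \<and> card (moved (\<psi> a)) \<le> card (moved (\<psi>' a)))"
proof -
  define t where "t = transpose (M + 1) (M + 2)"
  define \<psi>' where "\<psi>' a = (if evenperm (\<psi> a) then \<psi> a else \<psi> a \<circ> t)" for a
  have perm: "\<psi> a permutes {1..M}" if "a \<in> \<Phi>" for a using that assms by (simp add: perm_model_def)
  have sub: "{1..M} \<subseteq> {1..M + 2}" by auto
  have tp: "t permutes {1..M + 2}" unfolding t_def by (rule permutes_swap_id) auto
  have perm': "\<psi>' a permutes {1..M + 2}" if "a \<in> \<Phi>" for a
    using permutes_subset[OF perm[OF that] sub] tp by (auto simp: \<psi>'_def intro: permutes_compose)
  have ev: "evenperm (\<psi>' a)" if "a \<in> \<Phi>" for a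
    using permutes_imp_permutation[OF _ perm[OF that]]
    by (simp add: \<psi>'_def t_def evenperm_comp permutation_swap_id evenperm_swap)
  have low: "\<psi>' a z = \<psi> a z" if "z \<in> {1..M}" for a z
    using that by (simp add: \<psi>'_def t_def transpose_def)
  have high: "\<psi>' a z = (if evenperm (\<psi> a) then z else t z)" if "z \<in> {M + 1, M + 2}" "a \<in> \<Phi>" for a z
    using that permutes_not_in[OF perm[OF that(2)]] by (auto simp: \<psi>'_def t_def)
  have "perm_model G \<Phi> {1..M + 2} \<psi>' (2 * D)"
    unfolding perm_model_def
  proof (intro conjI ballI impI perm')
    assume "\<one>\<^bsub>G\<^esub> \<in> \<Phi>"
    then show "\<psi>' \<one>\<^bsub>G\<^esub> = id" using assms by (simp add: perm_model_def \<psi>'_def)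
  next
    fix a b assume ab: "a \<in> \<Phi>" "b \<in> \<Phi>" "a \<otimes>\<^bsub>G\<^esub> b \<in> \<Phi>"
    let ?S = "{z\<in>{1..M}. \<psi> a (\<psi> b z) \<noteq> \<psi> (a \<otimes>\<^bsub>G\<^esub> b) z}"
    let ?S' = "{z\<in>{1..M + 2}. \<psi>' a (\<psi>' b z) \<noteq> \<psi>' (a \<otimes>\<^bsub>G\<^esub> b) z}"
    let ?q = "\<psi> (a \<otimes>\<^bsub>G\<^esub> b)"
    have "card ?S \<le> D" using assms ab by (simp add: perm_model_def)
    have in_low: "\<psi> b z \<in> {1..M}" if "z \<in> {1..M}" for z
      using that permutes_in_image[OF perm[OF ab(2)]] by blast
    have split: "{1..M + 2} = {1..M} \<union> {M + 1, M + 2}" by auto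
    have tM: "t z \<in> {M + 1, M + 2}" "t (t z) = z" if "z \<in> {M + 1, M + 2}" for z
      using that by (auto simp: t_def)
    have S': "?S' \<subseteq> ?S \<union> {M + 1, M + 2}"
      unfolding split using low in_low by auto
    show "card ?S' \<le> 2 * D"
    proof (cases "evenperm ?q \<longleftrightarrow> (evenperm (\<psi> a) \<longleftrightarrow> evenperm (\<psi> b))")
      case True
      have "\<psi>' a (\<psi>' b z) = \<psi>' (a \<otimes>\<^bsub>G\<^esub> b) z" if "z \<in> {M + 1, M + 2}" for z
        using True that tM[OF that] by (simp add: high ab)
      then have "?S' \<subseteq> ?S" using S' by blast
      then have "card ?S' \<le> card ?S" by (intro card_mono) auto
      then show ?thesis using \<open>card ?S \<le> D\<close> by linarith
    next
      case False
      have pab: "\<psi> a \<circ> \<psi> b permutes {1..M}" using perm ab by (intro permutes_compose) auto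
      have "evenperm (\<psi> a \<circ> \<psi> b) \<longleftrightarrow> (evenperm (\<psi> a) \<longleftrightarrow> evenperm (\<psi> b))"
        using perm ab permutes_imp_permutation[OF finite_atLeastAtMost] by (intro evenperm_comp) blast+
      then have ne: "\<psi> a \<circ> \<psi> b \<noteq> ?q" using False by auto
      have "\<psi> a \<circ> \<psi> b \<circ> inv' ?q \<noteq> id"
      proof
        assume "\<psi> a \<circ> \<psi> b \<circ> inv' ?q = id"
        then have "\<psi> a \<circ> \<psi> b \<circ> (inv' ?q \<circ> ?q) = ?q" by (simp only: id_comp flip: comp_assoc)
        then show False using ne permutes_inv_o(2)[OF perm[OF ab(3)]] by (simp only: comp_id)
      qed
      moreover have "\<psi> a \<circ> \<psi> b \<circ> inv' ?q permutes {1..M}"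
        by (intro permutes_compose[OF permutes_inv pab] perm ab)
      ultimately have "2 \<le> card (moved (\<psi> a \<circ> \<psi> b \<circ> inv' ?q))"
        by (intro card_moved_ge_2[of "{1..M}"]) auto
      then have "2 \<le> card ?S" using card_moved_comp_inv[OF perm[OF ab(3)] pab] by simp
      moreover have "card ?S' \<le> card (?S \<union> {M + 1, M + 2})" using S' by (intro card_mono) auto
      moreover have "card (?S \<union> {M + 1, M + 2}) \<le> card ?S + card {M + 1, M + 2}" by (rule card_Un_le)
      ultimately show ?thesis using \<open>card ?S \<le> D\<close> by simp
    qed
  qed
  moreover have "card (moved (\<psi> a)) \<le> card (moved (\<psi>' a))" if "a \<in> \<Phi>" for a
  proof (rule card_mono)
    show "finite (moved (\<psi>' a))" using finite_moved[OF perm'[OF that]] by simp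
    have "z \<in> {1..M}" if "z \<in> moved (\<psi> a)" for z using that moved_permutes[OF perm[OF \<open>a \<in> \<Phi>\<close>]] by blast
    then show "moved (\<psi> a) \<subseteq> moved (\<psi>' a)" using low by (auto simp: moved_def)
  qed
  ultimately show ?thesis using ev by blast
qed

lemma card_moved_conj_prods:
  fixes H :: "(nat \<Rightarrow> nat) monoid" and M :: nat
  assumes "\<And>p. p \<in> carrier H \<Longrightarrow> p permutes {1..M} \<and> inv\<^bsub>H\<^esub> p = inv' p"
    and "mult H = (\<circ>)" "one H = id"
    and "\<And>x. x \<in> X \<Longrightarrow> card (moved x) \<le> D" and "y \<in> conj_prods n X H"
  shows "card (moved y) \<le> n * D"
proof -
  have "finite (moved (foldr (\<otimes>\<^bsub>H\<^esub>) (map (\<lambda>(x, g). inv\<^bsub>H\<^esub> g \<otimes>\<^bsub>H\<^esub> x \<otimes>\<^bsub>H\<^esub> g) ps) \<one>\<^bsub>H\<^esub>)) \<and>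
      card (moved (foldr (\<otimes>\<^bsub>H\<^esub>) (map (\<lambda>(x, g). inv\<^bsub>H\<^esub> g \<otimes>\<^bsub>H\<^esub> x \<otimes>\<^bsub>H\<^esub> g) ps) \<one>\<^bsub>H\<^esub>)) \<le> length ps * D"
    if "\<forall>(x, g) \<in> set ps. x \<in> carrier H \<and> (x \<in> X \<or> inv\<^bsub>H\<^esub> x \<in> X) \<and> g \<in> carrier H" for ps
    using that
  proof (induction ps)
    case Nil
    then show ?case by (simp add: assms(3) moved_def)
  next
    case (Cons xg ps)
    obtain x g where xg: "xg = (x, g)" by (cases xg)
    let ?r = "foldr (\<otimes>\<^bsub>H\<^esub>) (map (\<lambda>(x, g). inv\<^bsub>H\<^esub> g \<otimes>\<^bsub>H\<^esub> x \<otimes>\<^bsub>H\<^esub> g) ps) \<one>\<^bsub>H\<^esub>"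
    let ?c = "inv\<^bsub>H\<^esub> g \<otimes>\<^bsub>H\<^esub> x \<otimes>\<^bsub>H\<^esub> g"
    have x: "x \<in> carrier H" "x \<in> X \<or> inv\<^bsub>H\<^esub> x \<in> X" "g \<in> carrier H" using Cons.prems xg by auto
    have xp: "x permutes {1..M}" "g permutes {1..M}" using assms(1) x by auto
    have gb: "bij (inv' g)" using xp permutes_bij bij_imp_bij_inv by blast
    have c: "?c = inv' g \<circ> x \<circ> inv' (inv' g)"
      using assms(1)[OF x(3)] assms(2) permutes_inv_inv[OF xp(2)] by simp
    have fr: "finite (moved ?r)" "card (moved ?r) \<le> length ps * D" using Cons by auto
    have "card (moved ?c) = card (moved x)" unfolding c by (rule card_moved_conj[OF gb])
    also have "\<dots> \<le> D"
      using x(2) assms(1)[OF x(1)] assms(4) moved_inv[OF permutes_bij[OF xp(1)]] by metis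
    finally have cD: "card (moved ?c) \<le> D" .
    have "?c permutes {1..M}" unfolding c by (intro permutes_compose permutes_inv xp)
    then have fc: "finite (moved ?c)" by (rule finite_moved) simp
    have "card (moved (?c \<circ> ?r)) \<le> card (moved ?c) + card (moved ?r)"
      by (rule card_moved_comp[OF fc fr(1)])
    also have "\<dots> \<le> length (xg # ps) * D" using fr(2) cD by simp
    finally have "card (moved (?c \<circ> ?r)) \<le> length (xg # ps) * D" .
    moreover have "finite (moved (?c \<circ> ?r))"
      using moved_comp[of ?c ?r] fc fr(1) finite_subset by blast
    moreover have "foldr (\<otimes>\<^bsub>H\<^esub>) (map (\<lambda>(x, g). inv\<^bsub>H\<^esub> g \<otimes>\<^bsub>H\<^esub> x \<otimes>\<^bsub>H\<^esub> g) (xg # ps)) \<one>\<^bsub>H\<^esub> = ?c \<circ> ?r"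
      by (simp add: xg assms(2))
    ultimately show ?case by (simp only:)
  qed
  then show ?thesis using assms(5) unfolding conj_prods_def by blast
qed

lemma separated_perm_model:
  fixes H :: "(nat \<Rightarrow> nat) monoid" and M :: nat
  assumes H: "\<And>p. p \<in> carrier H \<Longrightarrow> p permutes {1..M} \<and> inv\<^bsub>H\<^esub> p = inv' p"
    "mult H = (\<circ>)" "one H = id"
    and "perm_model G \<Phi> {1..M} \<psi> D" "\<psi> \<in> \<Phi> \<rightarrow> carrier H"
    and "\<And>g. g \<in> Y \<Longrightarrow> n * D < card (moved (\<psi> g))"
  shows "separated_from n (\<psi> ` Y)
           {\<psi> g \<otimes>\<^bsub>H\<^esub> \<psi> h \<otimes>\<^bsub>H\<^esub> inv\<^bsub>H\<^esub> (\<psi> (g \<otimes>\<^bsub>G\<^esub> h)) | g h. g \<in> \<Phi> \<and> h \<in> \<Phi> \<and> g \<otimes>\<^bsub>G\<^esub> h \<in> \<Phi>} H"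
proof -
  have "card (moved x) \<le> D"
    if x: "x \<in> {\<psi> g \<otimes>\<^bsub>H\<^esub> \<psi> h \<otimes>\<^bsub>H\<^esub> inv\<^bsub>H\<^esub> (\<psi> (g \<otimes>\<^bsub>G\<^esub> h)) | g h. g \<in> \<Phi> \<and> h \<in> \<Phi> \<and> g \<otimes>\<^bsub>G\<^esub> h \<in> \<Phi>}" for x
  proof -
    obtain g h where gh: "g \<in> \<Phi>" "h \<in> \<Phi>" "g \<otimes>\<^bsub>G\<^esub> h \<in> \<Phi>"
      and "x = \<psi> g \<otimes>\<^bsub>H\<^esub> \<psi> h \<otimes>\<^bsub>H\<^esub> inv\<^bsub>H\<^esub> (\<psi> (g \<otimes>\<^bsub>G\<^esub> h))" using x by blast
    moreover have p: "\<psi> a permutes {1..M}" "inv\<^bsub>H\<^esub> (\<psi> a) = inv' (\<psi> a)" if "a \<in> \<Phi>" for a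
      using that assms(5) H(1) by (auto simp: Pi_iff)
    ultimately have "x = \<psi> g \<circ> \<psi> h \<circ> inv' (\<psi> (g \<otimes>\<^bsub>G\<^esub> h))" using H(2) by simp
    moreover have "\<psi> g \<circ> \<psi> h permutes {1..M}" using p gh by (intro permutes_compose) auto
    ultimately have "card (moved x) = card {z\<in>{1..M}. \<psi> g (\<psi> h z) \<noteq> \<psi> (g \<otimes>\<^bsub>G\<^esub> h) z}"
      using card_moved_comp_inv[OF p(1)[OF gh(3)]] by simp
    then show ?thesis using assms(4) gh by (simp add: perm_model_def)
  qed
  then have "card (moved y) \<le> n * D" if "y \<in> conj_prods n
      {\<psi> g \<otimes>\<^bsub>H\<^esub> \<psi> h \<otimes>\<^bsub>H\<^esub> inv\<^bsub>H\<^esub> (\<psi> (g \<otimes>\<^bsub>G\<^esub> h)) | g h. g \<in> \<Phi> \<and> h \<in> \<Phi> \<and> g \<otimes>\<^bsub>G\<^esub> h \<in> \<Phi>} H" for y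
    using card_moved_conj_prods[OF H _ that] by blast
  then show ?thesis using assms(6) unfolding separated_from_def by (auto simp: not_le[symmetric])
qed

lemma approximable_if_perm_models:
  assumes "\<And>\<Phi> g C. finite \<Phi> \<Longrightarrow> \<Phi> \<subseteq> carrier G \<Longrightarrow> g \<in> \<Phi> \<Longrightarrow> g \<noteq> \<one>\<^bsub>G\<^esub> \<Longrightarrow>
      \<exists>(m :: nat) \<psi> D. perm_model G \<Phi> {1..m} \<psi> D \<and> C * D < card (moved (\<psi> g))"
  shows "approximable (Alt :: (nat \<Rightarrow> nat) monoid set) G" "approximable (Sym :: (nat \<Rightarrow> nat) monoid set) G"
proof -
  have main: "\<exists>(M :: nat) \<psi> D. perm_model G \<Phi> {1..M} \<psi> D \<and> (\<forall>g\<in>\<Phi> - {\<one>\<^bsub>G\<^esub>}. n * D < card (moved (\<psi> g)))"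
    if \<Phi>: "finite \<Phi>" "\<Phi> \<subseteq> carrier G" for \<Phi> n
  proof -
    let ?I = "\<Phi> - {\<one>\<^bsub>G\<^esub>}"
    have "\<exists>t :: nat \<times> ('a \<Rightarrow> nat \<Rightarrow> nat) \<times> nat. perm_model G \<Phi> {1..fst t} (fst (snd t)) (snd (snd t)) \<and>
        (n * card ?I + 1) * snd (snd t) < card (moved (fst (snd t) g))" if "g \<in> ?I" for g
      using assms[OF \<Phi>, of g "n * card ?I + 1"] that by auto
    then have "\<exists>t :: 'a \<Rightarrow> nat \<times> ('a \<Rightarrow> nat \<Rightarrow> nat) \<times> nat. \<forall>g\<in>?I. perm_model G \<Phi> {1..fst (t g)} (fst (snd (t g))) (snd (snd (t g))) \<and>
        (n * card ?I + 1) * snd (snd (t g)) < card (moved (fst (snd (t g)) g))"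
      by (intro bchoice ballI)
    then obtain t :: "'a \<Rightarrow> nat \<times> ('a \<Rightarrow> nat \<Rightarrow> nat) \<times> nat" where
      t: "\<forall>g\<in>?I. perm_model G \<Phi> {1..fst (t g)} (fst (snd (t g))) (snd (snd (t g))) \<and>
        (n * card ?I + 1) * snd (snd (t g)) < card (moved (fst (snd (t g)) g))" by blast
    have I: "finite ?I" "?I \<subseteq> \<Phi>" using \<Phi>(1) by auto
    show ?thesis
      by (rule perm_model_combine[OF I, where m = "\<lambda>g. fst (t g)" and \<psi> = "\<lambda>g. fst (snd (t g))"
            and D = "\<lambda>g. snd (snd (t g))"]) (rule t[rule_format, THEN conjunct1] t[rule_format, THEN conjunct2], assumption)+
  qed
  show "approximable (Sym :: (nat \<Rightarrow> nat) monoid set) G"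
    unfolding approximable_def
  proof (intro allI impI)
    fix \<Phi> :: "'a set" and n :: nat
    assume \<Phi>: "finite \<Phi> \<and> \<Phi> \<subseteq> carrier G"
    obtain M :: nat and \<psi> D where model: "perm_model G \<Phi> {1..M} \<psi> D"
      and big: "\<forall>g\<in>\<Phi> - {\<one>\<^bsub>G\<^esub>}. n * D < card (moved (\<psi> g))"
      using main[OF \<Phi>[THEN conjunct1] \<Phi>[THEN conjunct2], of n] by (elim exE conjE)
    have "sym_group M \<in> Sym" unfolding Sym_def mem_Collect_eq using sym_group_is_group iso_refl by (intro conjI exI)
    moreover have car: "\<psi> \<in> \<Phi> \<rightarrow> carrier (sym_group M)"
      using model by (auto simp: perm_model_def sym_group_carrier)
    moreover have "\<one>\<^bsub>G\<^esub> \<in> \<Phi> \<longrightarrow> \<psi> \<one>\<^bsub>G\<^esub> = \<one>\<^bsub>sym_group M\<^esub>"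
      using model by (simp add: perm_model_def sym_group_one)
    moreover have "separated_from n (\<psi> ` (\<Phi> - {\<one>\<^bsub>G\<^esub>}))
        {\<psi> g \<otimes>\<^bsub>sym_group M\<^esub> \<psi> h \<otimes>\<^bsub>sym_group M\<^esub> inv\<^bsub>sym_group M\<^esub> (\<psi> (g \<otimes>\<^bsub>G\<^esub> h)) | g h.
          g \<in> \<Phi> \<and> h \<in> \<Phi> \<and> g \<otimes>\<^bsub>G\<^esub> h \<in> \<Phi>} (sym_group M)"
    proof (rule separated_perm_model[OF _ sym_group_mult sym_group_one model car])
      fix p assume "p \<in> carrier (sym_group M)"
      then show "p permutes {1..M} \<and> inv\<^bsub>sym_group M\<^esub> p = inv' p"
        using sym_group_carrier sym_group_inv_equality by blast
    qed (use big in simp)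
    ultimately show "\<exists>H\<in>(Sym :: (nat \<Rightarrow> nat) monoid set). \<exists>\<phi>\<in>\<Phi> \<rightarrow> carrier H. (\<one>\<^bsub>G\<^esub> \<in> \<Phi> \<longrightarrow> \<phi> \<one>\<^bsub>G\<^esub> = \<one>\<^bsub>H\<^esub>) \<and>
        separated_from n (\<phi> ` (\<Phi> - {\<one>\<^bsub>G\<^esub>}))
          {\<phi> g \<otimes>\<^bsub>H\<^esub> \<phi> h \<otimes>\<^bsub>H\<^esub> inv\<^bsub>H\<^esub> \<phi> (g \<otimes>\<^bsub>G\<^esub> h) |g h. g \<in> \<Phi> \<and> h \<in> \<Phi> \<and> g \<otimes>\<^bsub>G\<^esub> h \<in> \<Phi>} H"
      by (intro bexI[of _ "sym_group M"] bexI[of _ \<psi>] conjI)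
  qed
  show "approximable (Alt :: (nat \<Rightarrow> nat) monoid set) G"
    unfolding approximable_def
  proof (intro allI impI)
    fix \<Phi> :: "'a set" and n :: nat
    assume \<Phi>: "finite \<Phi> \<and> \<Phi> \<subseteq> carrier G"
    obtain M0 :: nat and \<psi>0 D0 where model0: "perm_model G \<Phi> {1..M0} \<psi>0 D0"
      and big0: "\<forall>g\<in>\<Phi> - {\<one>\<^bsub>G\<^esub>}. 2 * n * D0 < card (moved (\<psi>0 g))"
      using main[OF \<Phi>[THEN conjunct1] \<Phi>[THEN conjunct2], of "2 * n"] by (elim exE conjE)
    define M D where "M = M0 + 2" and "D = 2 * D0"
    obtain \<psi> where model: "perm_model G \<Phi> {1..M} \<psi> D"
      and ev: "\<forall>a\<in>\<Phi>. evenperm (\<psi> a) \<and> card (moved (\<psi>0 a)) \<le> card (moved (\<psi> a))"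
      using perm_model_even[OF model0] unfolding M_def D_def by (elim exE conjE)
    have big: "n * D < card (moved (\<psi> g))" if "g \<in> \<Phi> - {\<one>\<^bsub>G\<^esub>}" for g
    proof -
      have "2 * n * D0 < card (moved (\<psi>0 g))" "card (moved (\<psi>0 g)) \<le> card (moved (\<psi> g))"
        using that big0 ev by auto
      then show ?thesis unfolding D_def by (simp only: mult_ac)
    qed
    have "alt_group M \<in> Alt" unfolding Alt_def mem_Collect_eq using alt_group_is_group iso_refl by (intro conjI exI)
    moreover have car: "\<psi> \<in> \<Phi> \<rightarrow> carrier (alt_group M)"
      using model ev by (auto simp: perm_model_def alt_group_carrier)
    moreover have "\<one>\<^bsub>G\<^esub> \<in> \<Phi> \<longrightarrow> \<psi> \<one>\<^bsub>G\<^esub> = \<one>\<^bsub>alt_group M\<^esub>"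
      using model by (simp add: perm_model_def alt_group_one)
    moreover have "separated_from n (\<psi> ` (\<Phi> - {\<one>\<^bsub>G\<^esub>}))
        {\<psi> g \<otimes>\<^bsub>alt_group M\<^esub> \<psi> h \<otimes>\<^bsub>alt_group M\<^esub> inv\<^bsub>alt_group M\<^esub> (\<psi> (g \<otimes>\<^bsub>G\<^esub> h)) | g h.
          g \<in> \<Phi> \<and> h \<in> \<Phi> \<and> g \<otimes>\<^bsub>G\<^esub> h \<in> \<Phi>} (alt_group M)"
    proof (rule separated_perm_model[OF _ alt_group_mult alt_group_one model car])
      fix p assume "p \<in> carrier (alt_group M)"
      then show "p permutes {1..M} \<and> inv\<^bsub>alt_group M\<^esub> p = inv' p"
        using alt_group_carrier alt_group_inv_equality by blast
    qed (use big in simp)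
    ultimately show "\<exists>H\<in>(Alt :: (nat \<Rightarrow> nat) monoid set). \<exists>\<phi>\<in>\<Phi> \<rightarrow> carrier H. (\<one>\<^bsub>G\<^esub> \<in> \<Phi> \<longrightarrow> \<phi> \<one>\<^bsub>G\<^esub> = \<one>\<^bsub>H\<^esub>) \<and>
        separated_from n (\<phi> ` (\<Phi> - {\<one>\<^bsub>G\<^esub>}))
          {\<phi> g \<otimes>\<^bsub>H\<^esub> \<phi> h \<otimes>\<^bsub>H\<^esub> inv\<^bsub>H\<^esub> \<phi> (g \<otimes>\<^bsub>G\<^esub> h) |g h. g \<in> \<Phi> \<and> h \<in> \<Phi> \<and> g \<otimes>\<^bsub>G\<^esub> h \<in> \<Phi>} H"
      by (intro bexI[of _ "alt_group M"] bexI[of _ \<psi>] conjI)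
  qed
qed

section \<open>Normal subgroups of products\<close>

locale alt_sym_product =
  fixes H :: "nat \<Rightarrow> 'a monoid" and h :: "nat \<Rightarrow> 'a \<Rightarrow> nat \<Rightarrow> nat" and m :: "nat \<Rightarrow> nat"
    and N :: "(nat \<Rightarrow> 'a) set"
  assumes groups: "\<And>i. group (H i)"
    and homs: "\<And>i. h i \<in> hom (H i) (sym_group (m i))"
    and injs: "\<And>i. inj_on (h i) (carrier (H i))"
    and alts: "\<And>i. carrier (alt_group (m i)) \<subseteq> h i ` carrier (H i)"
    and normal_N: "N \<lhd> product_group UNIV H"
begin

definition P :: "(nat \<Rightarrow> 'a) monoid" where "P = product_group UNIV H"

definition act :: "(nat \<Rightarrow> 'a) \<Rightarrow> nat \<Rightarrow> nat \<Rightarrow> nat" where "act f i = h i (f i)"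

lemma group_P: "group P"
  unfolding P_def using groups by simp

sublocale P: group P
  by (rule group_P)

lemma normal_NP: "N \<lhd> P"
  using normal_N by (simp add: P_def)

lemma subgroup_N: "subgroup N P"
  using normal_NP by (simp add: normal_imp_subgroup)

lemma carrier_P: "f \<in> carrier P \<longleftrightarrow> (\<forall>i. f i \<in> carrier (H i))"
  by (auto simp: P_def)

lemma mult_P: "(f \<otimes>\<^bsub>P\<^esub> g) i = f i \<otimes>\<^bsub>H i\<^esub> g i"
  by (simp add: P_def)

lemma one_P: "\<one>\<^bsub>P\<^esub> i = \<one>\<^bsub>H i\<^esub>"
  by (simp add: P_def)

lemma act_permutes: "f \<in> carrier P \<Longrightarrow> act f i permutes {1..m i}"
  using homs[of i] sym_group_carrier by (auto simp: act_def carrier_P hom_def)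

lemma act_bij: "f \<in> carrier P \<Longrightarrow> bij (act f i)"
  using act_permutes permutes_bij by blast

lemma finite_moved_act: "f \<in> carrier P \<Longrightarrow> finite (moved (act f i))"
  using finite_moved[OF act_permutes] by simp

lemma act_mult:
  assumes "f \<in> carrier P" "g \<in> carrier P"
  shows "act (f \<otimes>\<^bsub>P\<^esub> g) i = act f i \<circ> act g i"
  using hom_mult[OF homs[of i]] assms unfolding act_def mult_P sym_group_mult carrier_P by blast

lemma act_one: "act \<one>\<^bsub>P\<^esub> i = id"
  using hom_one[OF homs[of i] groups sym_group_is_group] by (simp add: act_def one_P sym_group_one)

lemma act_inv:
  assumes "f \<in> carrier P"
  shows "act (inv\<^bsub>P\<^esub> f) i = inv' (act f i)"
proof -
  have "act f i \<circ> act (inv\<^bsub>P\<^esub> f) i = id"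
    using act_mult[OF assms P.inv_closed[OF assms], of i] P.r_inv[OF assms] act_one by metis
  moreover have "act (inv\<^bsub>P\<^esub> f) i \<circ> act f i = id"
    using act_mult[OF P.inv_closed[OF assms] assms, of i] P.l_inv[OF assms] act_one by metis
  ultimately show ?thesis by (metis inv_unique_comp)
qed

lemma act_inject:
  assumes "f \<in> carrier P" "g \<in> carrier P" "\<And>i. act f i = act g i"
  shows "f = g"
proof
  fix i
  show "f i = g i" using injs[of i] assms unfolding act_def carrier_P inj_on_def by blast
qed

lemma act_surj:
  assumes "\<And>i. p i \<in> carrier (alt_group (m i))"
  shows "\<exists>f \<in> carrier P. \<forall>i. act f i = p i"
proof -
  have "\<exists>y \<in> carrier (H i). h i y = p i" for i using alts[of i] assms by (metis imageE subsetD)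
  then obtain f where "\<And>i. f i \<in> carrier (H i) \<and> h i (f i) = p i" by metis
  then show ?thesis by (intro bexI[of _ f]) (auto simp: act_def carrier_P)
qed

lemma conj_quots_in_N:
  assumes "x \<in> N" "e \<in> carrier P" "\<And>i. act e i \<in> conj_quots (m i) (act x i) k"
  shows "e \<in> N"
  using assms(2,3)
proof (induction k arbitrary: e)
  case 0
  then have "e = \<one>\<^bsub>P\<^esub>" by (intro act_inject) (auto simp: act_one)
  then show ?case using subgroup_N subgroup.one_closed by blast
next
  case (Suc k)
  have x: "x \<in> carrier P" using assms(1) subgroup_N subgroup.mem_carrier by metis
  have "\<exists>u v r. u \<in> carrier (alt_group (m i)) \<and> v \<in> carrier (alt_group (m i)) \<and>
      r \<in> conj_quots (m i) (act x i) k \<and>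
      act e i = (u \<circ> act x i \<circ> inv' u) \<circ> (v \<circ> inv' (act x i) \<circ> inv' v) \<circ> r" for i
    using Suc.prems(2)[of i] unfolding conj_quots.simps conj_quot_def by blast
  then obtain u v r where uvr: "\<And>i. u i \<in> carrier (alt_group (m i))" "\<And>i. v i \<in> carrier (alt_group (m i))"
    "\<And>i. r i \<in> conj_quots (m i) (act x i) k"
    "\<And>i. act e i = (u i \<circ> act x i \<circ> inv' (u i)) \<circ> (v i \<circ> inv' (act x i) \<circ> inv' (v i)) \<circ> r i"
    by metis
  obtain a where a: "a \<in> carrier P" "\<And>i. act a i = u i" using act_surj[of u] uvr(1) by blast
  obtain b where b: "b \<in> carrier P" "\<And>i. act b i = v i" using act_surj[of v] uvr(2) by blast
  define c where "c = (a \<otimes>\<^bsub>P\<^esub> x \<otimes>\<^bsub>P\<^esub> inv\<^bsub>P\<^esub> a) \<otimes>\<^bsub>P\<^esub> (b \<otimes>\<^bsub>P\<^esub> inv\<^bsub>P\<^esub> x \<otimes>\<^bsub>P\<^esub> inv\<^bsub>P\<^esub> b)"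
  have cN: "c \<in> N"
    unfolding c_def using subgroup_N assms(1) a(1) b(1)
    by (intro subgroup.m_closed[OF subgroup_N] normal.inv_op_closed2[OF normal_NP] subgroup.m_inv_closed)
  then have cP: "c \<in> carrier P" using subgroup_N subgroup.mem_carrier by metis
  have act_c: "act c i = (u i \<circ> act x i \<circ> inv' (u i)) \<circ> (v i \<circ> inv' (act x i) \<circ> inv' (v i))" for i
    unfolding c_def using a b x by (simp only: act_mult act_inv P.m_closed P.inv_closed)
  define d where "d = inv\<^bsub>P\<^esub> c \<otimes>\<^bsub>P\<^esub> e"
  have dP: "d \<in> carrier P" using cP Suc.prems(1) by (simp add: d_def)
  have "act d i = r i" for i
  proof -
    have "act e i = act c i \<circ> r i" unfolding act_c by (rule uvr(4))
    then have "act d i = (inv' (act c i) \<circ> act c i) \<circ> r i"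
      unfolding d_def using cP Suc.prems(1) by (simp only: act_mult act_inv P.inv_closed comp_assoc)
    then show ?thesis using act_bij[OF cP, of i] by (simp only: bij_is_inj inv_o_cancel id_comp)
  qed
  then have "d \<in> N" using Suc.IH[OF dP] uvr(3) by simp
  moreover have "e = c \<otimes>\<^bsub>P\<^esub> d"
    unfolding d_def using cP Suc.prems(1) by (simp add: P.m_assoc[symmetric])
  ultimately show ?case using cN subgroup.m_closed[OF subgroup_N] by blast
qed

text \<open>The small factors are treated as a whole, since their normal subgroups are not
  controlled by numbers of moved points.\<close>

definition E :: "nat \<Rightarrow> (nat \<Rightarrow> nat) set" where
  "E i = (if m i < 24 then {id} else carrier (alt_group (m i)))"

lemma E_alt: "p \<in> E i \<Longrightarrow> p \<in> carrier (alt_group (m i))"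
  using id_in_alt by (auto simp: E_def split: if_splits)

lemma E_in_N:
  assumes "x \<in> N" "e \<in> carrier P" "\<And>i. act e i \<in> E i"
    and "\<And>i. card (moved (act e i)) \<le> c * card (moved (act x i))"
  shows "e \<in> N"
proof (rule conj_quots_in_N[OF assms(1,2)])
  have x: "x \<in> carrier P" using assms(1) subgroup_N subgroup.mem_carrier by metis
  show "act e i \<in> conj_quots (m i) (act x i) (16 * (18 * c + 4))" for i
  proof (cases "m i < 24")
    case True
    then have "act e i = id" using assms(3)[of i] by (simp add: E_def)
    then show ?thesis using id_in_conj_quots[OF act_bij[OF x]] by simp
  next
    case False
    then show ?thesis
      using alt_in_conj_quots[OF _ act_permutes[OF x] E_alt[OF assms(3)] assms(4)] by simp
  qed
qed

lemma E_in_N_finite: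
  assumes "finite X" "X \<subseteq> N" "e \<in> carrier P" "\<And>i. act e i \<in> E i"
    and "\<And>i. card (moved (act e i)) \<le> c * (\<Sum>x\<in>X. card (moved (act x i)))"
  shows "e \<in> N"
  using assms
proof (induction X arbitrary: e c rule: finite_induct)
  case empty
  then have "moved (act e i) = {}" for i
    using empty.prems(4)[of i] card_0_eq[OF finite_moved_act[OF empty.prems(2), of i]] by simp
  then have "e = \<one>\<^bsub>P\<^esub>" using empty.prems(2) moved_eq_empty act_one by (metis act_inject P.one_closed)
  then show ?case using subgroup_N subgroup.one_closed by blast
next
  case (insert x X)
  let ?T = "\<lambda>i. card (moved (act e i)) \<le> 2 * c * card (moved (act x i))"
  define e1 where "e1 = (\<lambda>i. if ?T i then e i else \<one>\<^bsub>P\<^esub> i)"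
  define e2 where "e2 = (\<lambda>i. if ?T i then \<one>\<^bsub>P\<^esub> i else e i)"
  have eP: "e1 \<in> carrier P" "e2 \<in> carrier P"
    using insert.prems(2) P.one_closed unfolding e1_def e2_def carrier_P by auto
  have act_e: "act e1 i = (if ?T i then act e i else id)" "act e2 i = (if ?T i then id else act e i)" for i
    using act_one[of i] by (auto simp: act_def e1_def e2_def)
  have idE: "id \<in> E i" for i using id_in_alt by (simp add: E_def)
  have "e1 \<in> N"
    by (rule E_in_N[of x _ "2 * c"]) (use insert.prems eP(1) idE in \<open>auto simp: act_e moved_def\<close>)
  moreover have "e2 \<in> N"
  proof (rule insert.IH[of _ "2 * c"])
    fix i
    have "card (moved (act e i)) \<le> c * card (moved (act x i)) + c * (\<Sum>x\<in>X. card (moved (act x i)))"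
      using insert.prems(4)[of i] insert.hyps by (simp add: algebra_simps)
    then show "card (moved (act e2 i)) \<le> 2 * c * (\<Sum>x\<in>X. card (moved (act x i)))"
      unfolding act_e(2) by (simp add: moved_def)
  qed (use insert.prems eP(2) idE in \<open>auto simp: act_e\<close>)
  moreover have "e = e1 \<otimes>\<^bsub>P\<^esub> e2"
  proof
    fix i
    have "e i \<in> carrier (H i)" using insert.prems(2) by (simp add: carrier_P)
    then show "e i = (e1 \<otimes>\<^bsub>P\<^esub> e2) i"
      using groups[of i] by (simp add: mult_P e1_def e2_def one_P group.is_monoid)
  qed
  ultimately show ?case using subgroup.m_closed[OF subgroup_N] by blast
qed

definition M :: "(nat \<Rightarrow> 'a) set" where
  "M = {e \<in> carrier P. \<forall>i. act e i \<in> E i}"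

lemma M_alt:
  "e \<in> M \<longleftrightarrow> e \<in> carrier P \<and> (\<forall>i. evenperm (act e i) \<and> (m i < 24 \<longrightarrow> act e i = id))"
proof -
  have "act e i \<in> E i \<longleftrightarrow> evenperm (act e i) \<and> (m i < 24 \<longrightarrow> act e i = id)" if "e \<in> carrier P" for i
    using act_permutes[OF that, of i] by (auto simp: E_def alt_group_carrier)
  then show ?thesis by (auto simp: M_def)
qed

lemma act_permutation: "f \<in> carrier P \<Longrightarrow> permutation (act f i)"
  using act_permutes permutes_imp_permutation finite_atLeastAtMost by blast

lemma normal_M: "M \<lhd> P"
proof (rule P.normal_invI)
  show "subgroup M P"
  proof
    show "M \<subseteq> carrier P" by (auto simp: M_def)
    show "x \<otimes>\<^bsub>P\<^esub> y \<in> M" if "x \<in> M" "y \<in> M" for x y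
      using that by (auto simp: M_alt act_mult evenperm_comp act_permutation)
    show "\<one>\<^bsub>P\<^esub> \<in> M" using act_one by (simp add: M_alt)
    show "inv\<^bsub>P\<^esub> x \<in> M" if "x \<in> M" for x
      using that by (auto simp: M_alt act_inv evenperm_inv act_permutation)
  qed
  show "x \<otimes>\<^bsub>P\<^esub> e \<otimes>\<^bsub>P\<^esub> inv\<^bsub>P\<^esub> x \<in> M" if "x \<in> carrier P" "e \<in> M" for x e
  proof -
    have e: "e \<in> carrier P" using that(2) by (simp add: M_def)
    have a: "act (x \<otimes>\<^bsub>P\<^esub> e \<otimes>\<^bsub>P\<^esub> inv\<^bsub>P\<^esub> x) i = act x i \<circ> act e i \<circ> inv' (act x i)" for i
      using that(1) e by (simp only: act_mult act_inv P.m_closed P.inv_closed)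
    have "act x i \<circ> inv' (act x i) = id" for i using act_bij[OF that(1), of i] by (metis bij_is_surj surj_iff)
    moreover have "evenperm (act x i \<circ> act e i \<circ> inv' (act x i))" for i
      using that act_permutation[OF that(1), of i] act_permutation[OF e, of i]
      by (simp add: M_alt evenperm_comp evenperm_inv permutation_compose permutation_inverse)
    ultimately show ?thesis using that e a by (auto simp: M_alt)
  qed
qed

definition K :: "(nat \<Rightarrow> 'a) set" where "K = N <#>\<^bsub>P\<^esub> M"

lemma normal_K: "K \<lhd> P"
  unfolding K_def by (rule P.normal_subgroup_set_mult_closed[OF normal_NP normal_M])

lemma subgroup_K: "subgroup K P"
  using normal_K normal_imp_subgroup by blast

lemma N_subset_K: "N \<subseteq> K"
proof
  fix x assume x: "x \<in> N"
  have "x \<otimes>\<^bsub>P\<^esub> \<one>\<^bsub>P\<^esub> \<in> K"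
    unfolding K_def set_mult_def using x subgroup.one_closed[OF normal_imp_subgroup[OF normal_M]] by blast
  then show "x \<in> K" using x subgroup.mem_carrier[OF subgroup_N] by simp
qed

lemma M_subset_K: "M \<subseteq> K"
proof
  fix x assume x: "x \<in> M"
  have "\<one>\<^bsub>P\<^esub> \<otimes>\<^bsub>P\<^esub> x \<in> K"
    unfolding K_def set_mult_def using x subgroup.one_closed[OF subgroup_N] by blast
  then show "x \<in> K" using x by (simp add: M_def)
qed

lemma K_bounded_in_N:
  assumes "finite X" "X \<subseteq> N" "f \<in> K"
    and bound: "\<And>i. card (moved (act f i)) \<le> c * (\<Sum>x\<in>X. card (moved (act x i)))"
  shows "f \<in> N"
proof -
  obtain \<nu> e where ne: "\<nu> \<in> N" "e \<in> M" "f = \<nu> \<otimes>\<^bsub>P\<^esub> e"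
    using assms(3) by (auto simp: K_def set_mult_def)
  have P: "\<nu> \<in> carrier P" "e \<in> carrier P"
    using ne subgroup.mem_carrier[OF subgroup_N] by (auto simp: M_def)
  then have fP: "f \<in> carrier P" by (simp add: ne(3))
  have e: "e = inv\<^bsub>P\<^esub> \<nu> \<otimes>\<^bsub>P\<^esub> f" using P by (simp add: ne(3) P.m_assoc[symmetric])
  have "e \<in> N"
  proof (rule E_in_N_finite[of "insert \<nu> X" _ "c + 1"])
    fix i
    let ?S = "\<Sum>x\<in>insert \<nu> X. card (moved (act x i))"
    have "act e i = inv' (act \<nu> i) \<circ> act f i"
      unfolding e using P fP by (simp only: act_mult act_inv P.inv_closed)
    then have "card (moved (act e i)) \<le> card (moved (act \<nu> i)) + card (moved (act f i))"
      using card_moved_comp[of "inv' (act \<nu> i)" "act f i"] moved_inv[OF act_bij[OF P(1)], of i]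
        finite_moved_act[OF P(1), of i] finite_moved_act[OF fP, of i] by simp
    moreover have "card (moved (act \<nu> i)) \<le> ?S"
      using assms(1) by (intro member_le_sum) auto
    moreover have "(\<Sum>x\<in>X. card (moved (act x i))) \<le> ?S"
      using assms(1) by (intro sum_mono2) auto
    then have "c * (\<Sum>x\<in>X. card (moved (act x i))) \<le> c * ?S" by (rule mult_le_mono2)
    ultimately show "card (moved (act e i)) \<le> (c + 1) * ?S"
      using bound[of i] unfolding add_mult_distrib by linarith
  qed (use assms ne P in \<open>auto simp: M_def\<close>)
  then show ?thesis using ne(1,3) subgroup.m_closed[OF subgroup_N] by blast
qed

definition \<beta> :: "(nat \<Rightarrow> 'a) \<Rightarrow> nat \<Rightarrow> nat \<Rightarrow> nat" where
  "\<beta> f i = (if m i < 24 then act f i else if evenperm (act f i) then id else transpose 1 2)"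

lemma \<beta>_permutes:
  assumes "f \<in> carrier P"
  shows "\<beta> f i permutes {1..24}"
proof -
  have "transpose 1 2 permutes {1..24 :: nat}" by (rule permutes_swap_id) auto
  moreover have "act f i permutes {1..24}" if "m i < 24"
    by (rule permutes_subset[OF act_permutes[OF assms]]) (use that in auto)
  ultimately show ?thesis by (simp add: \<beta>_def permutes_id)
qed

lemma \<beta>_mult:
  assumes "f \<in> carrier P" "g \<in> carrier P"
  shows "\<beta> (f \<otimes>\<^bsub>P\<^esub> g) i = \<beta> f i \<circ> \<beta> g i"
proof -
  have "transpose 1 2 \<circ> transpose 1 2 = (id :: nat \<Rightarrow> nat)" by simp
  then show ?thesis
    using evenperm_comp[OF act_permutation[OF assms(1)] act_permutation[OF assms(2)], of i i]
    by (auto simp: \<beta>_def act_mult[OF assms])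
qed

lemma \<beta>_eq_imp_coset_eq:
  assumes "f \<in> carrier P" "g \<in> carrier P" "\<beta> f = \<beta> g"
  shows "K #>\<^bsub>P\<^esub> f = K #>\<^bsub>P\<^esub> g"
proof -
  have "evenperm (act f i \<circ> inv' (act g i)) \<and> (m i < 24 \<longrightarrow> act f i \<circ> inv' (act g i) = id)" for i
  proof (cases "m i < 24")
    case True
    then have "act f i = act g i" using fun_cong[OF assms(3), of i] by (simp add: \<beta>_def)
    then have "act f i \<circ> inv' (act g i) = id" using act_bij[OF assms(2), of i] by (metis bij_is_surj surj_iff)
    then show ?thesis by simp
  next
    case False
    have "transpose 1 2 \<noteq> (id :: nat \<Rightarrow> nat)" by (metis id_apply one_eq_numeral_iff semiring_norm(85) transpose_apply_first)
    then have "evenperm (act f i) \<longleftrightarrow> evenperm (act g i)"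
      using False fun_cong[OF assms(3), of i] by (auto simp: \<beta>_def split: if_splits)
    then show ?thesis
      using False act_permutation[OF assms(1), of i] act_permutation[OF assms(2), of i]
      by (simp add: evenperm_comp evenperm_inv permutation_inverse)
  qed
  then have "f \<otimes>\<^bsub>P\<^esub> inv\<^bsub>P\<^esub> g \<in> M"
    using assms(1,2) by (simp only: M_alt act_mult act_inv P.m_closed P.inv_closed) blast
  then have "f \<in> K #>\<^bsub>P\<^esub> g"
    using subgroup.rcos_module_rev[OF subgroup_K group_P assms(2,1)] M_subset_K by blast
  then show ?thesis using P.repr_independence[OF _ assms(2) subgroup_K] by simp
qed

text \<open>The quotient by \<open>K\<close> is locally finite: elements constant on the fibres of
  \<open>i \<mapsto> (\<beta> f i)\<close> with \<open>f\<close> ranging over \<open>\<Phi>\<close> form a submonoid containing \<open>\<Phi>\<close>, and there are finitely many fibres.\<close>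

lemma finite_submonoid_mod_K:
  assumes "finite \<Phi>" "\<Phi> \<subseteq> carrier P"
  shows "\<exists>F. F \<subseteq> carrier P \<and> \<Phi> \<subseteq> F \<and> \<one>\<^bsub>P\<^esub> \<in> F \<and> (\<forall>p\<in>F. \<forall>q\<in>F. p \<otimes>\<^bsub>P\<^esub> q \<in> F) \<and>
           finite ((\<lambda>p. K #>\<^bsub>P\<^esub> p) ` F)"
proof -
  define F where "F = {p \<in> carrier P. \<forall>i j. (\<forall>f\<in>\<Phi>. \<beta> f i = \<beta> f j) \<longrightarrow> \<beta> p i = \<beta> p j}"
  define W where "W = {p. p permutes {1..24 :: nat}}"
  define key where "key i = restrict (\<lambda>f. \<beta> f i) \<Phi>" for i
  have finW: "finite W" unfolding W_def by (rule finite_permutations) simp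
  have key: "key i \<in> \<Phi> \<rightarrow>\<^sub>E W" for i
    using assms(2) \<beta>_permutes by (auto simp: key_def W_def)
  have key_eq: "\<beta> f i = \<beta> f j" if "key i = key j" "f \<in> \<Phi>" for i j f
    using fun_cong[OF that(1), of f] that(2) by (simp add: key_def)
  have "\<beta> ` F \<subseteq> (\<lambda>\<theta> i. \<theta> (key i)) ` ((\<Phi> \<rightarrow>\<^sub>E W) \<rightarrow>\<^sub>E W)"
  proof
    fix b assume "b \<in> \<beta> ` F"
    then obtain p where p: "p \<in> F" "b = \<beta> p" by blast
    define \<theta> where "\<theta> = restrict (\<lambda>k. \<beta> p (SOME i. key i = k)) (\<Phi> \<rightarrow>\<^sub>E W)"
    have "p \<in> carrier P" using p(1) by (simp add: F_def)
    then have "\<theta> \<in> (\<Phi> \<rightarrow>\<^sub>E W) \<rightarrow>\<^sub>E W" using \<beta>_permutes by (auto simp: \<theta>_def W_def)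
    moreover have "b = (\<lambda>i. \<theta> (key i))"
    proof
      fix i
      have "key (SOME j. key j = key i) = key i" by (rule someI[of _ i]) simp
      then have "\<beta> p (SOME j. key j = key i) = \<beta> p i"
        using p(1) key_eq unfolding F_def mem_Collect_eq by blast
      then show "b i = \<theta> (key i)" using key p(2) by (simp add: \<theta>_def)
    qed
    ultimately show "b \<in> (\<lambda>\<theta> i. \<theta> (key i)) ` ((\<Phi> \<rightarrow>\<^sub>E W) \<rightarrow>\<^sub>E W)" by blast
  qed
  moreover have "finite ((\<Phi> \<rightarrow>\<^sub>E W) \<rightarrow>\<^sub>E W)"
    using assms(1) finW by (intro finite_PiE) auto
  ultimately have fin: "finite (\<beta> ` F)" using finite_surj by blast
  have FP: "F \<subseteq> carrier P" by (auto simp: F_def)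
  have "(\<lambda>p. K #>\<^bsub>P\<^esub> p) ` F \<subseteq> (\<lambda>b. K #>\<^bsub>P\<^esub> inv_into F \<beta> b) ` (\<beta> ` F)"
  proof
    fix r assume "r \<in> (\<lambda>p. K #>\<^bsub>P\<^esub> p) ` F"
    then obtain p where p: "p \<in> F" "r = K #>\<^bsub>P\<^esub> p" by blast
    have "\<beta> p \<in> \<beta> ` F" using p(1) by (rule imageI)
    then have "\<beta> (inv_into F \<beta> (\<beta> p)) = \<beta> p" "inv_into F \<beta> (\<beta> p) \<in> F"
      by (rule f_inv_into_f, rule inv_into_into)
    then have "r = K #>\<^bsub>P\<^esub> inv_into F \<beta> (\<beta> p)"
      unfolding p(2) using p(1) FP by (intro \<beta>_eq_imp_coset_eq) auto
    then show "r \<in> (\<lambda>b. K #>\<^bsub>P\<^esub> inv_into F \<beta> b) ` (\<beta> ` F)" using \<open>\<beta> p \<in> \<beta> ` F\<close> by blast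
  qed
  then have "finite ((\<lambda>p. K #>\<^bsub>P\<^esub> p) ` F)" using finite_surj[OF fin] by blast
  moreover have "\<Phi> \<subseteq> F" using assms(2) by (auto simp: F_def)
  moreover have "\<one>\<^bsub>P\<^esub> \<in> F" using act_one by (auto simp: F_def \<beta>_def)
  moreover have "p \<otimes>\<^bsub>P\<^esub> q \<in> F" if "p \<in> F" "q \<in> F" for p q
  proof -
    have "p \<in> carrier P" "q \<in> carrier P" using that FP by auto
    then show ?thesis
      using that unfolding F_def mem_Collect_eq by (simp only: \<beta>_mult P.m_closed) metis
  qed
  ultimately show ?thesis using FP by blast
qed

text \<open>An element outside \<open>K\<close> is seen by the regular representation of a finite quotient; one in
  \<open>K - N\<close> moves, in some coordinate, many more points than all the defects together.\<close>

lemma perm_model_quotient: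
  assumes \<Phi>: "finite \<Phi>" "\<Phi> \<subseteq> carrier (P Mod N)" and g: "g \<in> \<Phi>" "g \<noteq> \<one>\<^bsub>P Mod N\<^esub>"
  shows "\<exists>(M :: nat) \<psi> D. perm_model (P Mod N) \<Phi> {1..M} \<psi> D \<and> C * D < card (moved (\<psi> g))"
proof -
  define f where "f a = (if a = N then \<one>\<^bsub>P\<^esub> else SOME p. p \<in> carrier P \<and> a = N #>\<^bsub>P\<^esub> p)" for a
  have NN: "N #>\<^bsub>P\<^esub> \<one>\<^bsub>P\<^esub> = N" using P.coset_join2[OF P.one_closed subgroup_N subgroup.one_closed[OF subgroup_N]] .
  have f: "f a \<in> carrier P \<and> N #>\<^bsub>P\<^esub> f a = a" if "a \<in> \<Phi>" for a
  proof (cases "a = N")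
    case True
    then show ?thesis using NN by (simp add: f_def)
  next
    case False
    have "\<exists>p. p \<in> carrier P \<and> a = N #>\<^bsub>P\<^esub> p" using that \<Phi>(2) unfolding carrier_FactGroup by blast
    then show ?thesis using someI_ex[of "\<lambda>p. p \<in> carrier P \<and> a = N #>\<^bsub>P\<^esub> p"] False by (simp add: f_def)
  qed
  have f_one: "f \<one>\<^bsub>P Mod N\<^esub> = \<one>\<^bsub>P\<^esub>" by (simp add: f_def)
  define d where "d a b = f a \<otimes>\<^bsub>P\<^esub> f b \<otimes>\<^bsub>P\<^esub> inv\<^bsub>P\<^esub> f (a \<otimes>\<^bsub>P Mod N\<^esub> b)" for a b
  have dN: "d a b \<in> N" if "a \<in> \<Phi>" "b \<in> \<Phi>" "a \<otimes>\<^bsub>P Mod N\<^esub> b \<in> \<Phi>" for a b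
  proof -
    have "N #>\<^bsub>P\<^esub> (f a \<otimes>\<^bsub>P\<^esub> f b) = a \<otimes>\<^bsub>P Mod N\<^esub> b"
      using normal.rcos_sum[OF normal_NP, of "f a" "f b"] f that by simp
    also have "\<dots> = N #>\<^bsub>P\<^esub> f (a \<otimes>\<^bsub>P Mod N\<^esub> b)" using f[OF that(3)] by simp
    finally have "f a \<otimes>\<^bsub>P\<^esub> f b \<in> N #>\<^bsub>P\<^esub> f (a \<otimes>\<^bsub>P Mod N\<^esub> b)"
      using P.rcos_self[OF _ subgroup_N, of "f a \<otimes>\<^bsub>P\<^esub> f b"] f that by simp
    then show ?thesis
      unfolding d_def using subgroup.rcos_module_imp[OF subgroup_N group_P] f[OF that(3)] by blast
  qed
  define X where "X = (\<lambda>(a, b). d a b) ` {(a, b) \<in> \<Phi> \<times> \<Phi>. a \<otimes>\<^bsub>P Mod N\<^esub> b \<in> \<Phi>}"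
  have "finite {(a, b) \<in> \<Phi> \<times> \<Phi>. a \<otimes>\<^bsub>P Mod N\<^esub> b \<in> \<Phi>}"
    by (rule finite_subset[of _ "\<Phi> \<times> \<Phi>"]) (use \<Phi>(1) in auto)
  then have X: "finite X" "X \<subseteq> N" using dN unfolding X_def by auto
  have dX: "d a b \<in> X" if "a \<in> \<Phi>" "b \<in> \<Phi>" "a \<otimes>\<^bsub>P Mod N\<^esub> b \<in> \<Phi>" for a b
    using that unfolding X_def by force
  have fgN: "f g \<notin> N"
  proof
    assume "f g \<in> N"
    then have "N #>\<^bsub>P\<^esub> f g = N" using P.coset_join2[OF _ subgroup_N] f[OF g(1)] by blast
    then show False using f[OF g(1)] g(2) by simp
  qed
  show ?thesis
  proof (cases "f g \<in> K")
    case True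
    then obtain i where i: "C * (\<Sum>x\<in>X. card (moved (act x i))) < card (moved (act (f g) i))"
      using K_bounded_in_N[OF X, of "f g" C] fgN by (meson not_le)
    define \<psi> where "\<psi> a = act (f a) i" for a
    have perm: "\<psi> a permutes {1..m i}" if "a \<in> \<Phi>" for a
      unfolding \<psi>_def using act_permutes f[OF that] by blast
    have "perm_model (P Mod N) \<Phi> {1..m i} \<psi> (\<Sum>x\<in>X. card (moved (act x i)))"
      unfolding perm_model_def
    proof (intro conjI ballI impI perm)
      show "\<psi> \<one>\<^bsub>P Mod N\<^esub> = id" unfolding \<psi>_def f_one by (rule act_one)
    next
      fix a b assume ab: "a \<in> \<Phi>" "b \<in> \<Phi>" "a \<otimes>\<^bsub>P Mod N\<^esub> b \<in> \<Phi>"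
      have "act (d a b) i = \<psi> a \<circ> \<psi> b \<circ> inv' (\<psi> (a \<otimes>\<^bsub>P Mod N\<^esub> b))"
        unfolding d_def \<psi>_def using f[OF ab(1)] f[OF ab(2)] f[OF ab(3)]
        by (simp only: act_mult act_inv P.m_closed P.inv_closed)
      moreover have "\<psi> a \<circ> \<psi> b permutes {1..m i}" using perm ab by (intro permutes_compose) auto
      ultimately have "card {z \<in> {1..m i}. \<psi> a (\<psi> b z) \<noteq> \<psi> (a \<otimes>\<^bsub>P Mod N\<^esub> b) z} = card (moved (act (d a b) i))"
        using card_moved_comp_inv[OF perm[OF ab(3)]] by simp
      also have "\<dots> \<le> (\<Sum>x\<in>X. card (moved (act x i)))"
        using X(1) dX[OF ab] by (intro member_le_sum) auto
      finally show "card {z \<in> {1..m i}. \<psi> a (\<psi> b z) \<noteq> \<psi> (a \<otimes>\<^bsub>P Mod N\<^esub> b) z} \<le> (\<Sum>x\<in>X. card (moved (act x i)))" .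
    qed
    moreover have "C * (\<Sum>x\<in>X. card (moved (act x i))) < card (moved (\<psi> g))" using i by (simp add: \<psi>_def)
    ultimately show ?thesis by (intro exI conjI)
  next
    case False
    have fP: "f ` \<Phi> \<subseteq> carrier P" using f by blast
    obtain F where F: "F \<subseteq> carrier P" "f ` \<Phi> \<subseteq> F" "\<one>\<^bsub>P\<^esub> \<in> F" "\<And>p q. p \<in> F \<Longrightarrow> q \<in> F \<Longrightarrow> p \<otimes>\<^bsub>P\<^esub> q \<in> F"
      "finite ((\<lambda>p. K #>\<^bsub>P\<^esub> p) ` F)"
      using finite_submonoid_mod_K[OF finite_imageI[OF \<Phi>(1)] fP] by blast
    define R where "R = (\<lambda>p. K #>\<^bsub>P\<^esub> p) ` F"
    define \<psi> where "\<psi> a r = (if r \<in> R then (K #>\<^bsub>P\<^esub> f a) <#>\<^bsub>P\<^esub> r else r)" for a r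
    have finR: "finite R" using F(5) by (simp add: R_def)
    have KK: "K #>\<^bsub>P\<^esub> \<one>\<^bsub>P\<^esub> = K" using P.coset_join2[OF P.one_closed subgroup_K subgroup.one_closed[OF subgroup_K]] .
    have ap: "\<psi> a (K #>\<^bsub>P\<^esub> p) = K #>\<^bsub>P\<^esub> (f a \<otimes>\<^bsub>P\<^esub> p)" "K #>\<^bsub>P\<^esub> (f a \<otimes>\<^bsub>P\<^esub> p) \<in> R"
      if "a \<in> \<Phi>" "p \<in> F" for a p
    proof -
      show "\<psi> a (K #>\<^bsub>P\<^esub> p) = K #>\<^bsub>P\<^esub> (f a \<otimes>\<^bsub>P\<^esub> p)"
        using normal.rcos_sum[OF normal_K, of "f a" p] f[OF that(1)] that(2) F(1) by (auto simp: \<psi>_def R_def)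
      have "f a \<in> F" using that(1) F(2) by blast
      then show "K #>\<^bsub>P\<^esub> (f a \<otimes>\<^bsub>P\<^esub> p) \<in> R" unfolding R_def using that(2) F(4) by blast
    qed
    have perm: "\<psi> a permutes R" if a: "a \<in> \<Phi>" for a
    proof (rule bij_imp_permutes)
      have "R \<subseteq> carrier (P Mod K)" unfolding R_def carrier_FactGroup using F(1) by blast
      moreover have "K #>\<^bsub>P\<^esub> f a \<in> carrier (P Mod K)" unfolding carrier_FactGroup using f[OF a] by blast
      ultimately have "inj_on (\<lambda>r. (K #>\<^bsub>P\<^esub> f a) <#>\<^bsub>P\<^esub> r) R"
        using group.inj_on_cmult[OF normal.factorgroup_is_group[OF normal_K], of "K #>\<^bsub>P\<^esub> f a"]
          inj_on_subset unfolding mult_FactGroup by blast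
      then have "inj_on (\<psi> a) R" by (simp add: inj_on_def \<psi>_def)
      moreover have "\<psi> a ` R \<subseteq> R" using ap[OF a] by (auto simp: R_def)
      ultimately show "bij_betw (\<psi> a) R R" using endo_inj_surj[OF finR] by (simp add: bij_betw_def)
    qed (simp add: \<psi>_def)
    have "perm_model (P Mod N) \<Phi> R \<psi> 0"
      unfolding perm_model_def
    proof (intro conjI ballI impI perm)
      show "\<psi> \<one>\<^bsub>P Mod N\<^esub> = id"
      proof
        fix r
        show "\<psi> \<one>\<^bsub>P Mod N\<^esub> r = id r"
        proof (cases "r \<in> R")
          case True
          then obtain p where "p \<in> carrier P" "r = K #>\<^bsub>P\<^esub> p" using F(1) by (auto simp: R_def)
          then show ?thesis
            using True normal.rcos_sum[OF normal_K P.one_closed, of p] by (simp add: \<psi>_def f_one[unfolded one_FactGroup])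
        qed (simp add: \<psi>_def)
      qed
    next
      fix a b assume ab: "a \<in> \<Phi>" "b \<in> \<Phi>" "a \<otimes>\<^bsub>P Mod N\<^esub> b \<in> \<Phi>"
      have c: "f a \<in> carrier P" "f b \<in> carrier P" "f (a \<otimes>\<^bsub>P Mod N\<^esub> b) \<in> carrier P" using f ab by auto
      have "f a \<otimes>\<^bsub>P\<^esub> f b \<in> K #>\<^bsub>P\<^esub> f (a \<otimes>\<^bsub>P Mod N\<^esub> b)"
        using subgroup.rcos_module_rev[OF subgroup_K group_P c(3) P.m_closed[OF c(1,2)]] dN[OF ab] N_subset_K
        unfolding d_def by blast
      then have eq: "K #>\<^bsub>P\<^esub> (f a \<otimes>\<^bsub>P\<^esub> f b) = K #>\<^bsub>P\<^esub> f (a \<otimes>\<^bsub>P Mod N\<^esub> b)"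
        using P.repr_independence[OF _ c(3) subgroup_K] by simp
      have "\<psi> a (\<psi> b r) = \<psi> (a \<otimes>\<^bsub>P Mod N\<^esub> b) r" if r: "r \<in> R" for r
      proof -
        obtain p where p: "p \<in> F" "r = K #>\<^bsub>P\<^esub> p" using r unfolding R_def by blast
        have pP: "p \<in> carrier P" using p(1) F(1) by blast
        have "f b \<in> F" using ab(2) F(2) by blast
        then have "\<psi> a (\<psi> b r) = K #>\<^bsub>P\<^esub> (f a \<otimes>\<^bsub>P\<^esub> (f b \<otimes>\<^bsub>P\<^esub> p))"
          using p F(4) by (simp only: ap ab)
        also have "\<dots> = K #>\<^bsub>P\<^esub> (f a \<otimes>\<^bsub>P\<^esub> f b \<otimes>\<^bsub>P\<^esub> p)" using c pP by (simp only: P.m_assoc)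
        also have "\<dots> = (K #>\<^bsub>P\<^esub> (f a \<otimes>\<^bsub>P\<^esub> f b)) <#>\<^bsub>P\<^esub> (K #>\<^bsub>P\<^esub> p)"
          using normal.rcos_sum[OF normal_K, of "f a \<otimes>\<^bsub>P\<^esub> f b" p] c pP by simp
        also have "\<dots> = \<psi> (a \<otimes>\<^bsub>P Mod N\<^esub> b) r" unfolding eq using r p(2) by (simp add: \<psi>_def)
        finally show ?thesis .
      qed
      then have "{r \<in> R. \<psi> a (\<psi> b r) \<noteq> \<psi> (a \<otimes>\<^bsub>P Mod N\<^esub> b) r} = {}" by blast
      then show "card {r \<in> R. \<psi> a (\<psi> b r) \<noteq> \<psi> (a \<otimes>\<^bsub>P Mod N\<^esub> b) r} \<le> 0" by (simp only: card.empty le_refl)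
    qed
    from perm_model_transport[OF finR this] obtain \<psi>' where \<psi>': "perm_model (P Mod N) \<Phi> {1..card R} \<psi>' 0"
      "\<forall>a\<in>\<Phi>. card (moved (\<psi>' a)) = card (moved (\<psi> a))" by (elim exE conjE)
    have "\<psi> g K = K #>\<^bsub>P\<^esub> f g" using ap(1)[OF g(1) F(3)] f[OF g(1)] unfolding KK by simp
    moreover have "K #>\<^bsub>P\<^esub> f g \<noteq> K" using False P.rcos_self[OF _ subgroup_K] f[OF g(1)] by metis
    ultimately have "K \<in> moved (\<psi> g)" by (simp add: moved_def)
    then have "0 < card (moved (\<psi> g))"
      using finite_moved[OF perm[OF g(1)] finR] card_gt_0_iff by blast
    then have "C * 0 < card (moved (\<psi>' g))" using \<psi>'(2) g(1) by simp
    then show ?thesis using \<psi>'(1) by (intro exI conjI)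
  qed
qed

lemma approximable_quotient:
  "approximable (Alt :: (nat \<Rightarrow> nat) monoid set) (product_group UNIV H Mod N)"
  "approximable (Sym :: (nat \<Rightarrow> nat) monoid set) (product_group UNIV H Mod N)"
  using approximable_if_perm_models[OF perm_model_quotient] unfolding P_def by blast+

end

lemma Alt_Sym_embedding:
  assumes "H \<in> Alt \<or> H \<in> Sym"
  shows "\<exists>n h. h \<in> hom H (sym_group n) \<and> inj_on h (carrier H) \<and> carrier (alt_group n) \<subseteq> h ` carrier H"
proof -
  obtain n K h where K: "K = alt_group n \<or> K = sym_group n" and h: "h \<in> iso H K"
    using assms unfolding Alt_def Sym_def is_iso_def by auto
  have "h \<in> hom H K" "bij_betw h (carrier H) (carrier K)" using h by (auto simp: iso_def)
  moreover have "carrier K \<subseteq> carrier (sym_group n)" "mult K = mult (sym_group n)"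
    "carrier (alt_group n) \<subseteq> carrier K"
    using K by (auto simp: alt_group_carrier sym_group_carrier alt_group_mult sym_group_mult)
  ultimately have "h \<in> hom H (sym_group n)" "inj_on h (carrier H)" "carrier (alt_group n) \<subseteq> h ` carrier H"
    by (auto simp: hom_def bij_betw_def)
  then show ?thesis by blast
qed

lemma alt_sym_product_embedding:
  assumes "\<And>i. H i \<in> Alt \<or> H i \<in> Sym" "N \<lhd> product_group UNIV H"
  shows "\<exists>h m. alt_sym_product H h m N"
proof -
  have "\<exists>n. \<exists>h. h \<in> hom (H i) (sym_group n) \<and> inj_on h (carrier (H i)) \<and> carrier (alt_group n) \<subseteq> h ` carrier (H i)" for i
    using Alt_Sym_embedding assms(1) .
  then have "\<exists>m. \<forall>i. \<exists>h. h \<in> hom (H i) (sym_group (m i)) \<and> inj_on h (carrier (H i)) \<and> carrier (alt_group (m i)) \<subseteq> h ` carrier (H i)"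
    by (intro choice allI)
  then obtain m where "\<forall>i. \<exists>h. h \<in> hom (H i) (sym_group (m i)) \<and> inj_on h (carrier (H i)) \<and> carrier (alt_group (m i)) \<subseteq> h ` carrier (H i)"
    by (elim exE)
  then have "\<exists>h. \<forall>i. h i \<in> hom (H i) (sym_group (m i)) \<and> inj_on (h i) (carrier (H i)) \<and> carrier (alt_group (m i)) \<subseteq> h i ` carrier (H i)"
    by (rule choice)
  then obtain h where "\<forall>i. h i \<in> hom (H i) (sym_group (m i)) \<and> inj_on (h i) (carrier (H i)) \<and> carrier (alt_group (m i)) \<subseteq> h i ` carrier (H i)"
    by (elim exE)
  moreover have "group (H i)" for i using assms(1)[of i] by (auto simp: Alt_def Sym_def)
  ultimately have "alt_sym_product H h m N" using assms(2) by (intro alt_sym_product.intro) auto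
  then show ?thesis by (intro exI)
qed

theorem corollary7:
  fixes H :: "nat \<Rightarrow> 'a monoid" and N :: "(nat \<Rightarrow> 'a) set"
  assumes "N \<lhd> product_group UNIV H"
  shows "((\<forall>i. H i \<in> Alt) \<longrightarrow>
            approximable (Alt :: (nat \<Rightarrow> nat) monoid set) (product_group UNIV H Mod N)) \<and>
         ((\<forall>i. H i \<in> Sym) \<longrightarrow>
            approximable (Sym :: (nat \<Rightarrow> nat) monoid set) (product_group UNIV H Mod N))"
proof (intro conjI impI)
  assume "\<forall>i. H i \<in> Alt"
  then obtain h m where "alt_sym_product H h m N"
    using alt_sym_product_embedding[OF _ assms] by blast
  then show "approximable (Alt :: (nat \<Rightarrow> nat) monoid set) (product_group UNIV H Mod N)"
    by (rule alt_sym_product.approximable_quotient)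
next
  assume "\<forall>i. H i \<in> Sym"
  then obtain h m where "alt_sym_product H h m N"
    using alt_sym_product_embedding[OF _ assms] by blast
  then show "approximable (Sym :: (nat \<Rightarrow> nat) monoid set) (product_group UNIV H Mod N)"
    by (rule alt_sym_product.approximable_quotient)
qed

end
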